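(* There exists a universal constant $A>0$ such that for every integer $n\ge1$ and every zonoid $Z\subset\mathbb{R}^{2n}$ with non-empty interior, $$\frac{c^Z_{lin}(Z)}{c(B^{2n})}\le A\left(\frac{\mathrm{Vol}(Z)}{\mathrm{Vol}(B^{2n})}\right)^{1/n}.$$
   Context: $\mathbb{R}^{2n}$ has coordinates $(x_1,y_1,\ldots,x_n,y_n)$, the standard symplectic form $\omega_{st}=\sum_{j=1}^n dx_j\wedge dy_j$ and the standard inner product. $B^{2n}$ is the open Euclidean unit ball in $\mathbb{R}^{2n}$, $B^{2k}(r)$ is the open ball of radius $r$ in $\mathbb{R}^{2k}$, and $Z^{2n}(r)=B^2(r)\times\mathbb{R}^{2n-2}$, where the factor $B^2(r)$ is in the $(x_1,y_1)$-plane. $\mathrm{Sp}(\mathbb{R}^{2n})$ is the group of linear maps of $\mathbb{R}^{2n}$ preserving $\omega_{st}$. The linearized cylindrical capacity of $U\subset\mathbb{R}^{2n}$ is $$c^Z_{lin}(U)=\inf\{\pi r^2 : \text{there exists }\psi\in\mathrm{Sp}(\mathbb{R}^{2n})\text{ with }\psi(U)\subset Z^{2n}(r)\}.$$ The quantity $c(B^{2n})$ is the common value $\pi$ taken on $B^{2n}$ by all (normalized) symplectic capacities $c$. A zonoid is a centrally symmetric ($Z=-Z$) convex body that can be approximated, in the Hausdorff sense, by Minkowski sums of finitely many line segments. $\mathrm{Vol}$ is Lebesgue measure. A universal constant does not depend on the dimension or on the body. *)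

theory Defs
  imports "HOL-Analysis.Analysis"
begin

text \<open>
  The dimension has to be quantified inside the theorem (the constant must not depend on it), so
  the spaces $\mathbb{R}^m$ cannot be given by types. They are realised as an increasing chain of
  linear subspaces of one real inner product space: the finitely supported real sequences with the
  inner product $\sum_i x_i y_i$. The linear, convex and metric notions of the library
  (\<open>linear\<close>, \<open>convex\<close>, \<open>compact\<close>, \<open>norm\<close>, \<open>ball\<close>, \<open>closed_segment\<close>, ...) then apply as they are
  and restrict on every $\mathbb{R}^m$ to the standard Euclidean ones.
\<close>

typedef fin_seq = "{f :: nat \<Rightarrow> real. finite {i. f i \<noteq> 0}}"
  morphisms coord Abs_fin_seq
  by (rule exI[of _ "\<lambda>_. 0"]) simp

setup_lifting type_definition_fin_seq

lemma finite_support: "finite {i. coord x i \<noteq> 0}"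
  using coord[of x] by simp

lemma fin_seq_eqI: "(\<And>i. coord x i = coord y i) \<Longrightarrow> x = y"
  by (metis coord_inject ext)

instantiation fin_seq :: real_vector
begin

lift_definition zero_fin_seq :: fin_seq is "\<lambda>_. 0" by simp

lift_definition plus_fin_seq :: "fin_seq \<Rightarrow> fin_seq \<Rightarrow> fin_seq" is "\<lambda>f g i. f i + g i"
proof -
  fix f g :: "nat \<Rightarrow> real"
  assume "finite {i. f i \<noteq> 0}" "finite {i. g i \<noteq> 0}"
  then show "finite {i. f i + g i \<noteq> 0}"
    by (rule finite_subset[rotated, OF finite_UnI]) auto
qed

lift_definition minus_fin_seq :: "fin_seq \<Rightarrow> fin_seq \<Rightarrow> fin_seq" is "\<lambda>f g i. f i - g i"
proof -
  fix f g :: "nat \<Rightarrow> real"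
  assume "finite {i. f i \<noteq> 0}" "finite {i. g i \<noteq> 0}"
  then show "finite {i. f i - g i \<noteq> 0}"
    by (rule finite_subset[rotated, OF finite_UnI]) auto
qed

lift_definition uminus_fin_seq :: "fin_seq \<Rightarrow> fin_seq" is "\<lambda>f i. - f i" by simp

lift_definition scaleR_fin_seq :: "real \<Rightarrow> fin_seq \<Rightarrow> fin_seq" is "\<lambda>c f i. c * f i"
proof -
  fix c and f :: "nat \<Rightarrow> real"
  assume "finite {i. f i \<noteq> 0}"
  then show "finite {i. c * f i \<noteq> 0}"
    by (rule finite_subset[rotated]) auto
qed

instance
  by standard (transfer; simp add: algebra_simps)+

end

lemma coord_simps [simp]:
  "coord 0 i = 0" "coord (x + y) i = coord x i + coord y i"
  "coord (x - y) i = coord x i - coord y i" "coord (- x) i = - coord x i"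
  "coord (c *\<^sub>R x) i = c * coord x i"
  by (transfer; simp)+

instantiation fin_seq :: real_inner
begin

definition inner_fin_seq :: "fin_seq \<Rightarrow> fin_seq \<Rightarrow> real" where
  "inner_fin_seq x y = (\<Sum>i | coord x i \<noteq> 0. coord x i * coord y i)"

definition norm_fin_seq :: "fin_seq \<Rightarrow> real" where
  "norm_fin_seq x = sqrt (inner x x)"

definition sgn_fin_seq :: "fin_seq \<Rightarrow> fin_seq" where
  "sgn_fin_seq x = x /\<^sub>R norm x"

definition dist_fin_seq :: "fin_seq \<Rightarrow> fin_seq \<Rightarrow> real" where
  "dist_fin_seq x y = norm (x - y)"

definition uniformity_fin_seq :: "(fin_seq \<times> fin_seq) filter" where
  "uniformity_fin_seq = (INF e\<in>{0<..}. principal {(x, y). dist (x :: fin_seq) y < e})"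

definition open_fin_seq :: "fin_seq set \<Rightarrow> bool" where
  "open_fin_seq U \<longleftrightarrow> (\<forall>x\<in>U. \<forall>\<^sub>F (x', y) in uniformity. x' = x \<longrightarrow> y \<in> U)"

lemma inner_fin_seq_superset:
  assumes "finite I" "{i. coord x i \<noteq> 0} \<subseteq> I"
  shows "inner x y = (\<Sum>i\<in>I. coord x i * coord y i)"
  unfolding inner_fin_seq_def using assms by (intro sum.mono_neutral_left) auto

instance
proof
  fix x y z :: fin_seq and c :: real
  define I where "I = {i. coord x i \<noteq> 0} \<union> {i. coord y i \<noteq> 0}"
  have I: "finite I" unfolding I_def by (intro finite_UnI finite_support)
  have inner_I: "inner u v = (\<Sum>i\<in>I. coord u i * coord v i)"
    if "\<And>i. i \<notin> I \<Longrightarrow> coord u i = 0" for u v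
    using that by (intro inner_fin_seq_superset I) auto
  have xI: "\<And>i. i \<notin> I \<Longrightarrow> coord x i = 0" and yI: "\<And>i. i \<notin> I \<Longrightarrow> coord y i = 0"
    by (auto simp: I_def)
  show "inner x y = inner y x"
    using inner_I[OF xI, of y] inner_I[OF yI, of x] by (simp add: mult.commute)
  show "inner (x + y) z = inner x z + inner y z"
    using inner_I[OF xI, of z] inner_I[OF yI, of z] inner_I[of "x + y" z] xI yI
    by (simp add: distrib_right sum.distrib)
  show "inner (c *\<^sub>R x) y = c * inner x y"
    using inner_I[OF xI, of y] inner_I[of "c *\<^sub>R x" y] xI
    by (simp add: sum_distrib_left mult.assoc)
  show "0 \<le> inner x x"
    unfolding inner_fin_seq_def by (intro sum_nonneg) simp
  show "inner x x = 0 \<longleftrightarrow> x = 0"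
  proof
    assume "inner x x = 0"
    then have "\<forall>i\<in>{i. coord x i \<noteq> 0}. coord x i * coord x i = 0"
      unfolding inner_fin_seq_def
      by (subst (asm) sum_nonneg_eq_0_iff[OF finite_support]) auto
    then show "x = 0" by (intro fin_seq_eqI) auto
  qed (simp add: inner_fin_seq_def)
  show "norm x = sqrt (inner x x)" by (rule norm_fin_seq_def)
  show "sgn x = x /\<^sub>R norm x" by (rule sgn_fin_seq_def)
  show "dist x y = norm (x - y)" by (rule dist_fin_seq_def)
  show "uniformity = (INF e\<in>{0<..}. principal {(x, y). dist (x :: fin_seq) y < e})"
    by (rule uniformity_fin_seq_def)
  show "open U \<longleftrightarrow> (\<forall>x\<in>U. \<forall>\<^sub>F (x', y) in uniformity. x' = x \<longrightarrow> y \<in> U)"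
    for U :: "fin_seq set"
    by (rule open_fin_seq_def)
qed

end

text \<open>$\mathbb{R}^m$; in $\mathbb{R}^{2n}$ the coordinates $x_j$ and $y_j$, $1 \le j \le n$, have the
  indices $2(j-1)$ and $2(j-1)+1$.\<close>

definition euc :: "nat \<Rightarrow> fin_seq set" where
  "euc m = {x. \<forall>i\<ge>m. coord x i = 0}"

lemma inner_euc:
  assumes "x \<in> euc m"
  shows "inner x y = (\<Sum>i<m. coord x i * coord y i)"
  using assms by (intro inner_fin_seq_superset) (auto simp: euc_def not_less[symmetric])

definition euc_ball :: "nat \<Rightarrow> real \<Rightarrow> fin_seq set" where
  "euc_ball m r = {x \<in> euc m. norm x < r}"

text \<open>The completed product measure is Lebesgue measure on $\mathbb{R}^m$, the latter as the space of
  the extensional functions on \<open>{..<m}\<close>. To be used for subsets of \<open>euc m\<close>.\<close>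

definition vol :: "nat \<Rightarrow> fin_seq set \<Rightarrow> real" where
  "vol m S = measure (completion (Pi\<^sub>M {..<m} (\<lambda>_. lborel)))
     ((\<lambda>x. restrict (coord x) {..<m}) ` S)"

definition omega_st :: "nat \<Rightarrow> fin_seq \<Rightarrow> fin_seq \<Rightarrow> real" where
  "omega_st n u v =
     (\<Sum>j<n. coord u (2*j) * coord v (2*j+1) - coord u (2*j+1) * coord v (2*j))"

text \<open>A linear map of $\mathbb{R}^{2n}$ is given by any linear extension of it to the ambient space.
  Preserving the nondegenerate form makes it bijective on $\mathbb{R}^{2n}$.\<close>

definition Sp :: "nat \<Rightarrow> (fin_seq \<Rightarrow> fin_seq) set" where
  "Sp n = {\<psi>. linear \<psi> \<and> \<psi> ` euc (2*n) \<subseteq> euc (2*n) \<and>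
     (\<forall>u\<in>euc (2*n). \<forall>v\<in>euc (2*n). omega_st n (\<psi> u) (\<psi> v) = omega_st n u v)}"

definition sympl_cylinder :: "nat \<Rightarrow> real \<Rightarrow> fin_seq set" where
  "sympl_cylinder n r =
     {z \<in> euc (2*n). \<exists>w\<in>euc_ball 2 r. coord z 0 = coord w 0 \<and> coord z 1 = coord w 1}"

text \<open>Extended real values, so that the infimum is \<open>\<infinity>\<close> if there is no such \<open>\<psi>\<close>.\<close>

definition c_lin_Z :: "nat \<Rightarrow> fin_seq set \<Rightarrow> ereal" where
  "c_lin_Z n U = Inf {ereal (pi * r\<^sup>2) |r. r > 0 \<and> (\<exists>\<psi>\<in>Sp n. \<psi> ` U \<subseteq> sympl_cylinder n r)}"

text \<open>Meaningful for nonempty bounded sets only.\<close>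

definition hausdorff_dist :: "'a::metric_space set \<Rightarrow> 'a set \<Rightarrow> real" where
  "hausdorff_dist S T = max (SUP x\<in>S. infdist x T) (SUP y\<in>T. infdist y S)"

text \<open>The sum of sets is the Minkowski sum of \<open>Set_Algebras\<close>.\<close>

definition zonotope :: "nat \<Rightarrow> fin_seq set \<Rightarrow> bool" where
  "zonotope m P \<longleftrightarrow> (\<exists>k a b. (\<forall>i<k. a i \<in> euc m \<and> b i \<in> euc m) \<and>
     P = (\<Sum>i<(k::nat). closed_segment (a i) (b i)))"

text \<open>Convex bodies are nonempty compact convex sets. The unary minus on sets is the complement,
  hence the image in the symmetry condition.\<close>

definition zonoid :: "nat \<Rightarrow> fin_seq set \<Rightarrow> bool" where
  "zonoid m Z \<longleftrightarrow> Z \<subseteq> euc m \<and> Z \<noteq> {} \<and> compact Z \<and> convex Z \<and> uminus ` Z = Z \<and>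
     (\<forall>\<epsilon>>0. \<exists>P. zonotope m P \<and> hausdorff_dist Z P < \<epsilon>)"

end

theory Submission
  imports Defs
begin

text \<open>Write $m = 2n$. The idea is to trap the zonoid in an ellipsoid whose volume exceeds that of the
  zonoid at most by a factor $C^m$, and then to solve the problem for ellipsoids, where it is linear
  algebra; the root in the inequality turns $C^m$ into a constant. For a general convex body the
  first step fails; for zonoids it is a rough form of a theorem of Lewis on subspaces of $L_1$.

  \<^medskip>
  \<^noindent> \<^emph>\<open>Reduction to sums of symmetric segments.\<close> Up to a factor 2 in every direction the zonoid is
  a sum $P = \sum_i [-v_i, v_i]$, in the sense that $P \subseteq 2Z$ and that the support function
  $h(u) = \sum_i |\langle u, v_i\rangle|$ of $P$ satisfies $h_Z \le 2h$ (\<open>zonoid_approx\<close>).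

  \<^medskip>
  \<^noindent> \<^emph>\<open>Position.\<close> Among the linear images choose $T$ such that $S^m / \det T$ with
  $S = \sum_i |T v_i|$ is minimal up to a constant factor. Comparing $T$ with its stretches in a single
  direction shows that the quadratic form $\sum_i \langle x, Tv_i\rangle^2 / |Tv_i|$ lies between two
  constant multiples of $(S/m)\,|x|^2$ (\<open>balanced_position\<close>). The upper bound and the
  Cauchy-Schwarz inequality give $h(u) \le C S m^{-1/2}\, |T'u|$, where $T'$ is the inverse of the
  adjoint of $T$. The lower bound gives $\mathrm{Vol}(TP) \ge (cS/m)^m$ (\<open>volume_segment_sum_ge\<close>), by
  induction on the dimension: to first order, a dilated zonotope gains the volumes of its shadows along
  the segments times the lengths of the segments, and the shadows inherit the hypothesis.

  \<^medskip>
  \<^noindent> \<^emph>\<open>Ellipsoids.\<close> Some $u$, $w$ satisfy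
  $\omega(u, w) \ge \frac12 (\det T)^{1/n}\, |T'u|\,|T'w|$: otherwise the complex structure, which
  preserves volume, would map the ellipsoid $\{|T'x| \le 1\}$ into one of smaller volume
  (\<open>ex_omega_st_large\<close>). After scaling to $\omega(u,w) = 1$, a linear symplectic map has
  $\langle u, \cdot\rangle$ and $\langle w, \cdot\rangle$ as its first two coordinates
  (\<open>c_lin_Z_le\<close>), so the capacity is at most a constant times $h(u)^2 + h(w)^2$, hence of order
  $(S^2/m) (\det T)^{-1/n}$, whereas $\mathrm{Vol}(P)^{1/n}$ is at least of order
  $(S/m)^2 (\det T)^{-1/n}$. The quotient is of order $m$, which is exactly the order of
  $\mathrm{Vol}(B^{2n})^{-1/n}$.

  \<^medskip>
  \<^noindent> Determinants never occur: the role of $\det T$ is played by the factor by which $T$ scales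
  Lebesgue measure, and all maps used are composed of reflections, stretches and shears, for
  which this factor follows from Fubini's theorem.\<close>

section \<open>Coordinates, and the topology of the finitely supported sequences\<close>

definition unit_seq :: "nat \<Rightarrow> fin_seq" where
  "unit_seq i = Abs_fin_seq (\<lambda>j. if j = i then 1 else 0)"

lemma coord_unit_seq [simp]: "coord (unit_seq i) j = (if j = i then 1 else 0)"
  unfolding unit_seq_def by (subst Abs_fin_seq_inverse) auto

lemma coord_sum [simp]: "coord (sum f A) i = (\<Sum>a\<in>A. coord (f a) i)"
  by (induction A rule: infinite_finite_induct) auto

lemma inner_unit_seq [simp]: "inner x (unit_seq i) = coord x i" "inner (unit_seq i) x = coord x i"
proof -
  show "inner (unit_seq i) x = coord x i"
    by (subst inner_fin_seq_superset[of "{i}"]) auto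
  then show "inner x (unit_seq i) = coord x i"
    by (simp add: inner_commute)
qed

lemma norm_unit_seq [simp]: "norm (unit_seq i) = 1"
  by (simp add: norm_eq_sqrt_inner)

lemma unit_seq_euc [simp]: "unit_seq i \<in> euc m \<longleftrightarrow> i < m"
  by (auto simp: euc_def)

lemma euc_mono: "m \<le> k \<Longrightarrow> x \<in> euc m \<Longrightarrow> x \<in> euc k"
  by (auto simp: euc_def)

lemma subspace_euc: "subspace (euc m)"
  by (auto simp: subspace_def euc_def)

lemmas euc_arith = subspace_add[OF subspace_euc] subspace_diff[OF subspace_euc]
  subspace_scale[OF subspace_euc] subspace_neg[OF subspace_euc] subspace_0[OF subspace_euc]
  subspace_sum[OF subspace_euc]

definition emb :: "nat \<Rightarrow> (nat \<Rightarrow> real) \<Rightarrow> fin_seq" where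
  "emb m f = (\<Sum>i<m. f i *\<^sub>R unit_seq i)"

lemma coord_emb [simp]: "coord (emb m f) j = (if j < m then f j else 0)"
  by (auto simp: emb_def if_distrib cong: if_cong)

lemma emb_euc [simp]: "emb m f \<in> euc m"
  by (auto simp: euc_def)

lemma emb_coord: "x \<in> euc m \<Longrightarrow> emb m (coord x) = x"
  by (rule fin_seq_eqI) (auto simp: euc_def)

lemma emb_cong: "(\<And>i. i < m \<Longrightarrow> f i = g i) \<Longrightarrow> emb m f = emb m g"
  by (auto simp: emb_def)

lemma emb_Suc: "emb (Suc m) f = emb m f + f m *\<^sub>R unit_seq m"
  by (simp add: emb_def)

lemma norm_euc: "x \<in> euc m \<Longrightarrow> (norm x)\<^sup>2 = (\<Sum>i<m. (coord x i)\<^sup>2)"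
  unfolding power2_norm_eq_inner by (simp add: inner_euc power2_eq_square)

lemma norm_le_sum_coord:
  assumes "x \<in> euc m"
  shows "norm x \<le> (\<Sum>i<m. \<bar>coord x i\<bar>)"
proof -
  have "norm (emb m (coord x)) \<le> (\<Sum>i<m. norm (coord x i *\<^sub>R unit_seq i))"
    unfolding emb_def by (rule norm_sum)
  then show ?thesis using assms by (simp add: emb_coord)
qed

lemma ex_euc: "\<exists>m. x \<in> euc m"
proof -
  have "bdd_above {i. coord x i \<noteq> 0}" by (intro bdd_above_finite finite_support)
  then obtain m where "\<And>i. coord x i \<noteq> 0 \<Longrightarrow> i \<le> m"
    by (auto simp: bdd_above_def)
  then show ?thesis by (intro exI[of _ "Suc m"]) (force simp: euc_def not_less_eq_eq)
qed

text \<open>The rational sequences are dense; second countability makes sums of Borel measurable maps into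
  \<open>fin_seq\<close> Borel measurable.\<close>

instance fin_seq :: second_countable_topology
proof
  define D :: "fin_seq set" where
    "D = (\<lambda>l::rat list. emb (length l) (\<lambda>i. real_of_rat (l ! i))) ` UNIV"
  have cD: "countable D" unfolding D_def by (intro countable_image) auto
  have dense: "\<exists>y\<in>D. dist y x < e" if "e > 0" for x e
  proof -
    obtain m where m: "x \<in> euc m" using ex_euc by blast
    have "\<exists>q. \<bar>real_of_rat q - coord x i\<bar> < e / (m + 1)" for i
    proof -
      have "0 < e / (m + 1)" using that by simp
      then obtain r where "r \<in> \<rat>" "coord x i < r" "r < coord x i + e / (m + 1)"
        using Rats_dense_in_real[of "coord x i" "coord x i + e / (m + 1)"] by auto
      then obtain q where "r = real_of_rat q" by (auto elim: Rats_cases)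
      with \<open>coord x i < r\<close> \<open>r < _\<close> show ?thesis by (intro exI[of _ q]) auto
    qed
    then obtain q where q: "\<And>i. \<bar>real_of_rat (q i) - coord x i\<bar> < e / (m + 1)" by metis
    define y where "y = emb m (\<lambda>i. real_of_rat (q i))"
    have "y = emb (length (map q [0..<m])) (\<lambda>i. real_of_rat (map q [0..<m] ! i))"
      unfolding y_def by (auto intro!: emb_cong)
    then have "y \<in> D" unfolding D_def by blast
    moreover have "dist y x < e"
    proof -
      have "norm (y - x) \<le> (\<Sum>i<m. \<bar>coord (y - x) i\<bar>)"
        by (rule norm_le_sum_coord) (auto simp: y_def intro!: euc_arith m)
      also have "\<dots> \<le> (\<Sum>i<m. e / (m + 1))"
        using q by (intro sum_mono) (auto simp: y_def intro!: less_imp_le)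
      also have "\<dots> = e * (m / (m + 1))" by simp
      also have "\<dots> < e * 1" using that by (intro mult_strict_left_mono) auto
      finally show ?thesis by (simp add: dist_norm)
    qed
    ultimately show ?thesis by blast
  qed
  define B where "B = (\<lambda>(y, k). ball y (1 / Suc k)) ` (D \<times> (UNIV :: nat set))"
  have "countable B" unfolding B_def using cD by (intro countable_image countable_SIGMA) auto
  moreover have "topological_basis B"
  proof (rule topological_basisI)
    show "open b" if "b \<in> B" for b using that by (auto simp: B_def)
    fix U :: "fin_seq set" and x assume "open U" "x \<in> U"
    then obtain e where e: "e > 0" "ball x e \<subseteq> U" by (meson openE)
    obtain k where k: "2 / e < real k" using reals_Archimedean2 by blast
    have k': "2 * (1 / Suc k) < e"
    proof -
      have "2 / e < real (Suc k)" using k by simp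
      then show ?thesis using e by (simp add: field_simps)
    qed
    obtain y where y: "y \<in> D" "dist y x < 1 / Suc k"
      using dense[of "1 / Suc k" x] by (auto simp: field_simps)
    have "ball y (1 / Suc k) \<subseteq> ball x e"
    proof
      fix z assume "z \<in> ball y (1 / Suc k)"
      then have "dist y z < 1 / Suc k" by simp
      with y(2) have "dist x z < 1 / Suc k + 1 / Suc k"
        by (metis add_strict_mono dist_commute dist_triangle_less_add)
      with k' show "z \<in> ball x e" by simp
    qed
    with e y show "\<exists>b\<in>B. x \<in> b \<and> b \<subseteq> U"
      unfolding B_def by (intro bexI[of _ "ball y (1 / Suc k)"]) auto
  qed
  ultimately show "\<exists>B::fin_seq set set. countable B \<and> open = generate_topology B"
    using topological_basis_imp_subbasis by blast
qed

lemma continuous_on_coord [continuous_intros]: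
  "continuous_on S f \<Longrightarrow> continuous_on S (\<lambda>x. coord (f x) i)"
  by (simp flip: inner_unit_seq(1)) (intro continuous_intros)

lemma closed_euc: "closed (euc m)"
proof -
  have "euc m = (\<Inter>i\<in>{m..}. {x. coord x i = 0})" by (auto simp: euc_def)
  moreover have "closed {x. coord x i = 0}" for i
    by (intro closed_Collect_eq continuous_intros)
  ultimately show ?thesis by auto
qed

lemma measurable_coord [measurable]: "(\<lambda>x. coord x i) \<in> borel_measurable borel"
  by (intro borel_measurable_continuous_onI continuous_intros)

section \<open>Lebesgue measure on finitely supported sequences\<close>

text \<open>A Borel measure on the whole space of sequences that is concentrated on \<open>euc m\<close>. In this way
  all dimensions live on one measurable space, and maps of \<open>euc m\<close> can be any Borel maps.\<close>

definition leb :: "nat \<Rightarrow> fin_seq measure" where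
  "leb m = distr (Pi\<^sub>M {..<m} (\<lambda>_. lborel)) borel (emb m)"

lemma measurable_emb [measurable]: "emb m \<in> measurable (Pi\<^sub>M {..<m} (\<lambda>_. lborel)) borel"
proof -
  have "(\<lambda>f. f i *\<^sub>R unit_seq i) \<in> borel_measurable (Pi\<^sub>M {..<m} (\<lambda>_. lborel))"
    if "i < m" for i
    using that by (intro borel_measurable_scaleR measurable_component_singleton[THEN measurable_compose] borel_measurable_const) auto
  show ?thesis
    unfolding emb_def by (intro borel_measurable_sum) auto
qed

lemma sets_leb [simp, measurable_cong]: "sets (leb m) = sets borel"
  and space_leb [simp]: "space (leb m) = UNIV"
  by (auto simp: leb_def)

lemma vol_eq_leb:
  assumes "S \<in> sets borel" "S \<subseteq> euc m"
  shows "vol m S = measure (leb m) S"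
proof -
  let ?M = "Pi\<^sub>M {..<m} (\<lambda>_. lborel) :: (nat \<Rightarrow> real) measure"
  have "emb m -` S \<inter> space ?M \<in> sets ?M" using assms by measurable
  moreover have "emb m -` S \<inter> space ?M = (\<lambda>x. restrict (coord x) {..<m}) ` S"
  proof (intro equalityI subsetI)
    fix f assume f: "f \<in> emb m -` S \<inter> space ?M"
    then have "f = restrict (coord (emb m f)) {..<m}"
      by (auto simp: space_PiM PiE_def extensional_def restrict_def)
    with f show "f \<in> (\<lambda>x. restrict (coord x) {..<m}) ` S" by (intro image_eqI[of _ _ "emb m f"]) auto
  next
    fix f assume "f \<in> (\<lambda>x. restrict (coord x) {..<m}) ` S"
    then obtain x where x: "f = restrict (coord x) {..<m}" "x \<in> S" by auto
    then have "emb m f = x"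
      using emb_coord[of x m] emb_cong[of m f "coord x"] assms by auto
    with x show "f \<in> emb m -` S \<inter> space ?M" by (auto simp: space_PiM)
  qed
  ultimately show ?thesis
    using assms by (simp add: vol_def leb_def measure_distr)
qed

lemma nn_integral_leb:
  "f \<in> borel_measurable borel \<Longrightarrow>
    (\<integral>\<^sup>+x. f x \<partial>leb m) = (\<integral>\<^sup>+x. f (emb m x) \<partial>Pi\<^sub>M {..<m} (\<lambda>_. lborel))"
  unfolding leb_def by (rule nn_integral_distr) auto

interpretation lebesgue_product: product_sigma_finite "\<lambda>_::nat. lborel :: real measure"
  by standard

lemma emeasure_leb_cball:
  assumes "r > 0"
  shows "emeasure (leb m) (cball 0 r) = ennreal (unit_ball_vol (real m) * r ^ m)"
proof -
  have "emb m -` cball 0 r \<inter> space (Pi\<^sub>M {..<m} (\<lambda>_. lborel)) =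
      {f. sqrt (\<Sum>i\<in>{..<m}. (f i)\<^sup>2) \<le> r} \<inter> space (Pi\<^sub>M {..<m} (\<lambda>_. lborel))"
    by (auto simp: norm_eq_sqrt_inner inner_euc[of _ m] power2_eq_square)
  then show ?thesis
    using emeasure_cball_aux[OF _ assms, of "{..<m}"]
    by (simp add: leb_def emeasure_distr)
qed

interpretation leb: sigma_finite_measure "leb m" for m
proof
  show "\<exists>A. countable A \<and> A \<subseteq> sets (leb m) \<and> \<Union> A = space (leb m) \<and> (\<forall>a\<in>A. emeasure (leb m) a \<noteq> \<infinity>)"
  proof (intro exI conjI)
    show "countable (range (\<lambda>k::nat. cball 0 (real (Suc k))))" by auto
    show "\<Union> (range (\<lambda>k::nat. cball (0::fin_seq) (real (Suc k)))) = space (leb m)"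
    proof -
      have "\<exists>k. norm x \<le> real (Suc k)" for x :: fin_seq
        using real_arch_simple[of "norm x"] by (metis Suc_leD le_SucI of_nat_le_iff order.trans order_refl)
      then show ?thesis by auto
    qed
  qed (auto simp: emeasure_leb_cball)
qed

text \<open>Fubini's theorem for the last coordinate; all volume computations rest on it.\<close>

lemma nn_integral_leb_Suc:
  assumes [measurable]: "f \<in> borel_measurable borel"
  shows "(\<integral>\<^sup>+x. f x \<partial>leb (Suc m)) = (\<integral>\<^sup>+x. (\<integral>\<^sup>+t. f (x + t *\<^sub>R unit_seq m) \<partial>lborel) \<partial>leb m)"
proof -
  have ins: "{..<Suc m} = insert m {..<m}" by auto
  have m1: "(\<lambda>x. f (emb (Suc m) x)) \<in> borel_measurable (Pi\<^sub>M (insert m {..<m}) (\<lambda>_. lborel))"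
    unfolding ins[symmetric] by measurable
  have "(\<integral>\<^sup>+x. f x \<partial>leb (Suc m)) = 
      (\<integral>\<^sup>+x. (\<integral>\<^sup>+t. f (emb (Suc m) (x(m := t))) \<partial>lborel) \<partial>Pi\<^sub>M {..<m} (\<lambda>_. lborel))"
    by (subst nn_integral_leb[OF assms], subst ins, 
        subst lebesgue_product.product_nn_integral_insert) (auto intro: m1)
  also have "\<dots> = (\<integral>\<^sup>+x. (\<integral>\<^sup>+t. f (emb m x + t *\<^sub>R unit_seq m) \<partial>lborel) \<partial>Pi\<^sub>M {..<m} (\<lambda>_. lborel))"
    by (intro nn_integral_cong arg_cong[where f=f]) (auto simp: emb_Suc intro!: emb_cong)
  also have "\<dots> = (\<integral>\<^sup>+x. (\<integral>\<^sup>+t. f (x + t *\<^sub>R unit_seq m) \<partial>lborel) \<partial>leb m)"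
    by (subst nn_integral_leb) measurable
  finally show ?thesis .
qed

section \<open>Linear maps that scale the volume\<close>

text \<open>The number \<open>d\<close> takes the place of the modulus of the determinant. Stating it by pulling back
  integrands makes it multiplicative under composition without any injectivity requirement.\<close>

definition scales_volume :: "nat \<Rightarrow> (fin_seq \<Rightarrow> fin_seq) \<Rightarrow> real \<Rightarrow> bool" where
  "scales_volume m T d \<longleftrightarrow> d > 0 \<and> T \<in> borel_measurable borel \<and>
    (\<forall>f\<in>borel_measurable borel. (\<integral>\<^sup>+x. f (T x) \<partial>leb m) * ennreal d = (\<integral>\<^sup>+x. f x \<partial>leb m))"

lemma scales_volumeI:
  assumes "d > 0" "T \<in> borel_measurable borel"
    "\<And>f. f \<in> borel_measurable borel \<Longrightarrow> (\<integral>\<^sup>+x. f (T x) \<partial>leb m) * ennreal d = (\<integral>\<^sup>+x. f x \<partial>leb m)"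
  shows "scales_volume m T d"
  using assms by (auto simp: scales_volume_def)

lemma scales_volumeD:
  assumes "scales_volume m T d"
  shows "d > 0" "T \<in> borel_measurable borel"
    "f \<in> borel_measurable borel \<Longrightarrow> (\<integral>\<^sup>+x. f (T x) \<partial>leb m) * ennreal d = (\<integral>\<^sup>+x. f x \<partial>leb m)"
  using assms by (auto simp: scales_volume_def)

lemma scales_volume_id: "scales_volume m (\<lambda>x. x) 1"
  by (rule scales_volumeI) auto

lemma scales_volume_comp:
  assumes T: "scales_volume m T d" and U: "scales_volume m U e"
  shows "scales_volume m (\<lambda>x. T (U x)) (d * e)"
proof (rule scales_volumeI)
  note [measurable] = scales_volumeD(2)[OF T] scales_volumeD(2)[OF U]
  show "0 < d * e" using T U by (auto simp: scales_volume_def)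
  show "(\<lambda>x. T (U x)) \<in> borel_measurable borel" by measurable
  fix f :: "fin_seq \<Rightarrow> ennreal" assume [measurable]: "f \<in> borel_measurable borel"
  have "(\<integral>\<^sup>+x. f (T (U x)) \<partial>leb m) * ennreal (d * e) = (\<integral>\<^sup>+x. f (T (U x)) \<partial>leb m) * ennreal e * ennreal d"
    using scales_volumeD(1)[OF T] scales_volumeD(1)[OF U]
    by (simp add: ennreal_mult mult_ac)
  also have "(\<integral>\<^sup>+x. f (T (U x)) \<partial>leb m) * ennreal e = (\<integral>\<^sup>+x. f (T x) \<partial>leb m)"
    using scales_volumeD(3)[OF U, of "\<lambda>x. f (T x)"] by simp
  also have "\<dots> * ennreal d = (\<integral>\<^sup>+x. f x \<partial>leb m)"
    using scales_volumeD(3)[OF T, of f] by simp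
  finally show "(\<integral>\<^sup>+x. f (T (U x)) \<partial>leb m) * ennreal (d * e) = (\<integral>\<^sup>+x. f x \<partial>leb m)" .
qed

lemma scales_volume_emeasure:
  assumes T: "scales_volume m T d" and S: "S \<in> sets borel"
  shows "emeasure (leb m) (T -` S) * ennreal d = emeasure (leb m) S"
proof -
  note [measurable] = scales_volumeD(2)[OF T] S
  have v: "T -` S \<in> sets borel"
    using measurable_sets[OF scales_volumeD(2)[OF T] S] by simp
  have "(\<integral>\<^sup>+x. indicator S (T x) \<partial>leb m) = (\<integral>\<^sup>+x. indicator (T -` S) x \<partial>leb m)"
    by (intro nn_integral_cong) (auto simp: indicator_def)
  also have "\<dots> = emeasure (leb m) (T -` S)"
    using v by (subst nn_integral_indicator) auto
  finally show ?thesis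
    using scales_volumeD(3)[OF T, of "indicator S"] S by simp
qed

lemma nn_integral_leb_cong:
  assumes "f \<in> borel_measurable borel" "g \<in> borel_measurable borel" "\<And>x. x \<in> euc m \<Longrightarrow> f x = g x"
  shows "(\<integral>\<^sup>+x. f x \<partial>leb m) = (\<integral>\<^sup>+x. g x \<partial>leb m)"
  using assms by (simp add: nn_integral_leb)

lemma nn_integral_leb_mono:
  assumes "f \<in> borel_measurable borel" "g \<in> borel_measurable borel" "\<And>x. x \<in> euc m \<Longrightarrow> f x \<le> g x"
  shows "(\<integral>\<^sup>+x. f x \<partial>leb m) \<le> (\<integral>\<^sup>+x. g x \<partial>leb m)"
  using assms by (simp add: nn_integral_leb nn_integral_mono)

lemma emeasure_leb_cong:
  assumes "S \<in> sets borel" "R \<in> sets borel" "S \<inter> euc m = R \<inter> euc m"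
  shows "emeasure (leb m) S = emeasure (leb m) R"
proof -
  have "(\<integral>\<^sup>+x. indicator S x \<partial>leb m) = (\<integral>\<^sup>+x. indicator R x \<partial>leb m)"
    using assms by (intro nn_integral_leb_cong) (auto simp: indicator_def)
  then show ?thesis using assms by simp
qed

text \<open>Maps that respect the fibration by lines parallel to the last axis and are affine on each line.
  The offset \<open>\<phi>\<close> may depend on the line, since one-dimensional Lebesgue measure is
  translation invariant.\<close>

lemma scales_volume_fibre:
  assumes g: "scales_volume m g d" and k: "k \<noteq> 0"
    and [measurable]: "\<phi> \<in> borel_measurable borel" "T \<in> borel_measurable borel"
    and T: "\<And>x t. x \<in> euc m \<Longrightarrow> T (x + t *\<^sub>R unit_seq m) = g x + (\<phi> x + k * t) *\<^sub>R unit_seq m"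
  shows "scales_volume (Suc m) T (d * \<bar>k\<bar>)"
proof (rule scales_volumeI)
  note [measurable] = scales_volumeD(2)[OF g]
  have d: "d > 0" using scales_volumeD(1)[OF g] .
  show "0 < d * \<bar>k\<bar>" using k d by simp
  fix f :: "fin_seq \<Rightarrow> ennreal" assume [measurable]: "f \<in> borel_measurable borel"
  define G where "G x = (\<integral>\<^sup>+t. f (x + t *\<^sub>R unit_seq m) \<partial>lborel)" for x
  have [measurable]: "G \<in> borel_measurable borel" unfolding G_def by measurable
  have "(\<integral>\<^sup>+x. f (T x) \<partial>leb (Suc m)) * ennreal \<bar>k\<bar>
      = (\<integral>\<^sup>+x. (\<integral>\<^sup>+t. f (T (x + t *\<^sub>R unit_seq m)) \<partial>lborel) \<partial>leb m) * ennreal \<bar>k\<bar>"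
    by (subst nn_integral_leb_Suc) measurable
  also have "\<dots> = (\<integral>\<^sup>+x. (\<integral>\<^sup>+t. f (T (x + t *\<^sub>R unit_seq m)) \<partial>lborel) * ennreal \<bar>k\<bar> \<partial>leb m)"
    by (subst nn_integral_multc) measurable
  also have "\<dots> = (\<integral>\<^sup>+x. G (g x) \<partial>leb m)"
  proof (rule nn_integral_leb_cong)
    fix x assume "x \<in> euc m"
    then have "(\<integral>\<^sup>+t. f (T (x + t *\<^sub>R unit_seq m)) \<partial>lborel)
      = (\<integral>\<^sup>+t. f (g x + (\<phi> x + k * t) *\<^sub>R unit_seq m) \<partial>lborel)" by (simp add: T)
    also have "\<dots> * ennreal \<bar>k\<bar> = G (g x)"
      unfolding G_def
      using nn_integral_real_affine[of "\<lambda>t. f (g x + t *\<^sub>R unit_seq m)" k "\<phi> x"] k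
      by (simp add: mult.commute)
    finally show "(\<integral>\<^sup>+t. f (T (x + t *\<^sub>R unit_seq m)) \<partial>lborel) * ennreal \<bar>k\<bar> = G (g x)" .
  qed measurable
  finally have 1: "(\<integral>\<^sup>+x. f (T x) \<partial>leb (Suc m)) * ennreal \<bar>k\<bar> = (\<integral>\<^sup>+x. G (g x) \<partial>leb m)" .
  have "(\<integral>\<^sup>+x. f (T x) \<partial>leb (Suc m)) * ennreal (d * \<bar>k\<bar>)
      = (\<integral>\<^sup>+x. f (T x) \<partial>leb (Suc m)) * ennreal \<bar>k\<bar> * ennreal d"
    using d by (simp add: ennreal_mult mult_ac)
  also have "\<dots> = (\<integral>\<^sup>+x. G x \<partial>leb m)"
    unfolding 1 using scales_volumeD(3)[OF g, of G] by simp
  also have "\<dots> = (\<integral>\<^sup>+x. f x \<partial>leb (Suc m))"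
    unfolding G_def by (subst nn_integral_leb_Suc) measurable
  finally show "(\<integral>\<^sup>+x. f (T x) \<partial>leb (Suc m)) * ennreal (d * \<bar>k\<bar>) = (\<integral>\<^sup>+x. f x \<partial>leb (Suc m))" .
qed measurable

lemma euc_0: "x \<in> euc 0 \<longleftrightarrow> x = 0"
  by (auto simp: euc_def intro: fin_seq_eqI)

lemma euc_Suc_decomp:
  assumes "x \<in> euc (Suc m)"
  obtains y where "y \<in> euc m" "x = y + coord x m *\<^sub>R unit_seq m"
proof
  show "x - coord x m *\<^sub>R unit_seq m \<in> euc m"
    using assms by (auto simp: euc_def)
qed simp

lemma scales_volume_translation: "a \<in> euc m \<Longrightarrow> scales_volume m (\<lambda>x. x + a) 1"
proof (induction m arbitrary: a)
  case 0
  then show ?case by (simp add: euc_0 scales_volume_id)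
next
  case (Suc m)
  from Suc.prems obtain b where b: "b \<in> euc m" "a = b + coord a m *\<^sub>R unit_seq m"
    by (rule euc_Suc_decomp)
  have *: "x + t *\<^sub>R unit_seq m + a = x + b + (coord a m + 1 * t) *\<^sub>R unit_seq m" for x t
    by (subst b(2)) (simp add: algebra_simps)
  have "scales_volume (Suc m) (\<lambda>x. x + a) (1 * \<bar>1\<bar>)"
    by (rule scales_volume_fibre[OF Suc.IH[OF b(1)], of 1 "\<lambda>_. coord a m"]) (simp_all add: *)
  then show ?case by simp
qed

lemma scales_volume_scaleR: "c > 0 \<Longrightarrow> scales_volume m (\<lambda>x. c *\<^sub>R x) (c ^ m)"
proof (induction m)
  case 0
  have "(\<integral>\<^sup>+x. f (c *\<^sub>R x) \<partial>leb 0) = (\<integral>\<^sup>+x. f x \<partial>leb 0)" if [measurable]: "f \<in> borel_measurable borel" for f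
    by (rule nn_integral_leb_cong) (auto simp: euc_0)
  then show ?case by (intro scales_volumeI) auto
next
  case (Suc m)
  have "scales_volume (Suc m) (\<lambda>x. c *\<^sub>R x) (c ^ m * \<bar>c\<bar>)"
    using Suc.prems by (intro scales_volume_fibre[OF Suc.IH, of c "\<lambda>_. 0"]) (auto simp: algebra_simps)
  then show ?case using Suc.prems by (simp add: mult.commute)
qed

text \<open>Shears in the other direction are translations of the slices \<open>coord x m = t\<close>, so the order
  of integration is exchanged first.\<close>

lemma scales_volume_shear:
  assumes c: "c \<in> euc m"
  shows "scales_volume (Suc m) (\<lambda>x. x + coord x m *\<^sub>R c) 1"
proof (rule scales_volumeI)
  fix f :: "fin_seq \<Rightarrow> ennreal" assume [measurable]: "f \<in> borel_measurable borel"
  interpret pair_sigma_finite "leb m" "lborel :: real measure" ..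
  have "(\<integral>\<^sup>+x. f (x + coord x m *\<^sub>R c) \<partial>leb (Suc m))
      = (\<integral>\<^sup>+x. (\<integral>\<^sup>+t. f (x + t *\<^sub>R unit_seq m + (coord x m + t) *\<^sub>R c) \<partial>lborel) \<partial>leb m)"
    by (subst nn_integral_leb_Suc) (auto simp: algebra_simps)
  also have "\<dots> = (\<integral>\<^sup>+x. (\<integral>\<^sup>+t. f (x + t *\<^sub>R c + t *\<^sub>R unit_seq m) \<partial>lborel) \<partial>leb m)"
    by (rule nn_integral_leb_cong) (auto simp: euc_def algebra_simps)
  also have "\<dots> = (\<integral>\<^sup>+t. (\<integral>\<^sup>+x. f (x + t *\<^sub>R c + t *\<^sub>R unit_seq m) \<partial>leb m) \<partial>lborel)"
    by (rule Fubini'[symmetric]) measurable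
  also have "\<dots> = (\<integral>\<^sup>+t. (\<integral>\<^sup>+x. f (x + t *\<^sub>R unit_seq m) \<partial>leb m) \<partial>lborel)"
  proof (rule nn_integral_cong)
    fix t
    have "scales_volume m (\<lambda>x. x + t *\<^sub>R c) 1"
      by (intro scales_volume_translation euc_arith c)
    from scales_volumeD(3)[OF this, of "\<lambda>x. f (x + t *\<^sub>R unit_seq m)"]
    show "(\<integral>\<^sup>+x. f (x + t *\<^sub>R c + t *\<^sub>R unit_seq m) \<partial>leb m) = (\<integral>\<^sup>+x. f (x + t *\<^sub>R unit_seq m) \<partial>leb m)"
      by simp
  qed
  also have "\<dots> = (\<integral>\<^sup>+x. (\<integral>\<^sup>+t. f (x + t *\<^sub>R unit_seq m) \<partial>lborel) \<partial>leb m)"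
    by (rule Fubini') measurable
  also have "\<dots> = (\<integral>\<^sup>+x. f x \<partial>leb (Suc m))"
    by (subst nn_integral_leb_Suc) measurable
  finally show "(\<integral>\<^sup>+x. f (x + coord x m *\<^sub>R c) \<partial>leb (Suc m)) * ennreal 1 = (\<integral>\<^sup>+x. f x \<partial>leb (Suc m))"
    by simp
qed auto

text \<open>For \<open>w = 0\<close> this is the identity, because the quotient is 0. That makes
  \<open>reflection_swap\<close> hold without a case distinction.\<close>

definition reflection :: "fin_seq \<Rightarrow> fin_seq \<Rightarrow> fin_seq" where
  "reflection w x = x - (2 * inner w x / inner w w) *\<^sub>R w"

lemma linear_reflection: "linear (reflection w)"
  by (rule linearI) (auto simp: reflection_def inner_right_distrib scaleR_left_distrib algebra_simps
      add_divide_distrib)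

lemma continuous_on_reflection: "continuous_on S (reflection w)"
proof -
  have "reflection w = (\<lambda>x. x - (inner w x * (2 / inner w w)) *\<^sub>R w)"
    by (auto simp: reflection_def)
  then show ?thesis by (simp only:) (intro continuous_intros)
qed

lemma measurable_reflection [measurable]: "reflection w \<in> borel_measurable borel"
  by (intro borel_measurable_continuous_onI continuous_on_reflection)

lemma reflection_euc: "w \<in> euc m \<Longrightarrow> x \<in> euc m \<Longrightarrow> reflection w x \<in> euc m"
  unfolding reflection_def by (intro euc_arith)

lemma inner_reflection: "inner (reflection w x) y = inner x (reflection w y)"
  by (simp add: reflection_def inner_diff_left inner_diff_right inner_commute)

lemma reflection_reflection [simp]: "reflection w (reflection w x) = x"
  by (cases "w = 0") (auto simp: reflection_def inner_diff_right algebra_simps)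

lemma norm_reflection [simp]: "norm (reflection w x) = norm x"
  by (simp add: norm_eq_sqrt_inner inner_reflection)

lemma reflection_swap:
  assumes "norm a = norm b"
  shows "reflection (a - b) a = b"
proof (cases "a = b")
  case False
  have *: "inner a a = inner b b" using assms by (simp add: norm_eq_sqrt_inner)
  have "inner (a - b) (a - b) = 2 * inner (a - b) a"
    by (simp add: inner_diff_left inner_diff_right inner_commute * )
  then have "reflection (a - b) a = a - (inner (a - b) (a - b) / inner (a - b) (a - b)) *\<^sub>R (a - b)"
    unfolding reflection_def by (simp only:)
  also have "inner (a - b) (a - b) / inner (a - b) (a - b) = 1"
    using False by (intro divide_self) simp
  finally show ?thesis by simp
qed (simp add: reflection_def)

text \<open>If \<open>w\<close> has a component along the last axis, a shear carries the axis to the line of \<open>w\<close>;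
  conjugated by it, the reflection flips the lines parallel to the last axis. If
  there is no such component, the dimension can be lowered.\<close>

lemma scales_volume_reflection: "w \<in> euc m \<Longrightarrow> scales_volume m (reflection w) 1"
proof (induction m)
  case 0
  then show ?case by (simp add: euc_0 reflection_def[abs_def] scales_volume_id)
next
  case (Suc m)
  show ?case
  proof (cases "coord w m = 0")
    case True
    with Suc.prems have w: "w \<in> euc m"
      by (auto simp: euc_def) (metis le_antisym not_less_eq_eq)
    have "scales_volume (Suc m) (reflection w) (1 * \<bar>1\<bar>)"
      by (rule scales_volume_fibre[OF Suc.IH[OF w], of 1 "\<lambda>_. 0"])
        (auto simp: reflection_def inner_right_distrib True)
    then show ?thesis by simp
  next
    case False
    define \<mu> where "\<mu> = coord w m"
    have w0: "inner w w \<noteq> 0" using False by auto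
    have \<mu>: "\<mu> \<noteq> 0" using False by (simp add: \<mu>_def)
    define c where "c = (1 / \<mu>) *\<^sub>R w - unit_seq m"
    have c: "c \<in> euc m"
      using Suc.prems \<mu> by (auto simp: c_def euc_def \<mu>_def)
    have w: "w = \<mu> *\<^sub>R c + \<mu> *\<^sub>R unit_seq m"
      using \<mu> by (simp add: c_def algebra_simps)
    have cm: "coord c m = 0" using c by (simp add: euc_def)
    define S where "S x = x + coord x m *\<^sub>R c" for x
    define S' where "S' x = x + coord x m *\<^sub>R (- c)" for x
    have S: "scales_volume (Suc m) S 1"
      unfolding S_def by (rule scales_volume_shear[OF c])
    have S': "scales_volume (Suc m) S' 1"
      unfolding S'_def by (rule scales_volume_shear) (intro euc_arith c)
    have SS': "S (S' x) = x" for x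
      by (simp add: S_def S'_def cm)
    note [measurable] = scales_volumeD(2)[OF S] scales_volumeD(2)[OF S']
    define F where "F x = S' (reflection w (S x))" for x
    have "scales_volume (Suc m) F (1 * \<bar>-1\<bar>)"
    proof (rule scales_volume_fibre[OF scales_volume_id, of _ "\<lambda>x. - (2 * inner w x * \<mu> / inner w w)"])
      show "F \<in> borel_measurable borel" unfolding F_def by measurable
      fix x t assume x: "x \<in> euc m"
      have xm: "coord x m = 0" using x by (simp add: euc_def)
      define l where "l = - (t / \<mu>) - 2 * inner w x / inner w w"
      have "S (x + t *\<^sub>R unit_seq m) = x + (t / \<mu>) *\<^sub>R w"
        using \<mu> by (simp add: S_def xm c_def algebra_simps)
      then have "reflection w (S (x + t *\<^sub>R unit_seq m)) = x + l *\<^sub>R w"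
      proof -
        assume *: "S (x + t *\<^sub>R unit_seq m) = x + (t / \<mu>) *\<^sub>R w"
        have "2 * inner w (x + (t / \<mu>) *\<^sub>R w) / inner w w = 2 * inner w x / inner w w + 2 * (t / \<mu>)"
          using w0 by (simp add: inner_right_distrib add_divide_distrib)
        then show ?thesis
          unfolding * reflection_def by (simp add: l_def algebra_simps flip: scaleR_left_distrib)
      qed
      then have "F (x + t *\<^sub>R unit_seq m) = x + l *\<^sub>R w - (l * \<mu>) *\<^sub>R c"
        by (simp add: F_def S'_def xm flip: \<mu>_def)
      also have "\<dots> = x + (l * \<mu>) *\<^sub>R unit_seq m"
        by (subst (1) w) (simp add: algebra_simps)
      also have "l * \<mu> = - (2 * inner w x * \<mu> / inner w w) + -1 * t"
        using \<mu> by (simp add: l_def algebra_simps)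
      finally show "F (x + t *\<^sub>R unit_seq m) =
          x + (- (2 * inner w x * \<mu> / inner w w) + -1 * t) *\<^sub>R unit_seq m" .
    qed auto
    then have F: "scales_volume (Suc m) F 1" by simp
    have "scales_volume (Suc m) (\<lambda>x. S (F (S' x))) (1 * (1 * 1))"
      by (rule scales_volume_comp[OF S scales_volume_comp[OF F S']])
    moreover have "S (F (S' x)) = reflection w x" for x
      by (simp add: F_def SS')
    ultimately show ?thesis by simp
  qed
qed

text \<open>Multiplication by \<open>1 + s\<close> in the direction of the unit vector \<open>a\<close>.\<close>

definition stretch :: "fin_seq \<Rightarrow> real \<Rightarrow> fin_seq \<Rightarrow> fin_seq" where
  "stretch a s x = x + (s * inner a x) *\<^sub>R a"

lemma linear_stretch: "linear (stretch a s)"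
  by (rule linearI) (auto simp: stretch_def inner_right_distrib algebra_simps)

lemma measurable_stretch [measurable]: "stretch a s \<in> borel_measurable borel"
  unfolding stretch_def by (intro borel_measurable_continuous_onI continuous_intros)

lemma stretch_euc: "a \<in> euc m \<Longrightarrow> x \<in> euc m \<Longrightarrow> stretch a s x \<in> euc m"
  unfolding stretch_def by (intro euc_arith)

lemma inner_stretch: "inner (stretch a s x) y = inner x (stretch a s y)"
  by (simp add: stretch_def inner_add_left inner_add_right inner_commute)

lemma stretch_stretch:
  assumes "norm a = 1" "s > -1"
  shows "stretch a s (stretch a (1 / (1 + s) - 1) x) = x"
proof -
  have "inner a a = 1" using assms by (simp add: norm_eq_sqrt_inner)
  then have "stretch a s (stretch a (1 / (1 + s) - 1) x)
    = x + ((1 / (1 + s) - 1 + s + s * (1 / (1 + s) - 1)) * inner a x) *\<^sub>R a"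
    by (simp add: stretch_def inner_add_right algebra_simps)
  also have "1 / (1 + s) - 1 + s + s * (1 / (1 + s) - 1) = 0"
    using assms by (simp add: field_simps)
  finally show ?thesis by simp
qed

text \<open>A reflection turns \<open>a\<close> into the last coordinate direction.\<close>

lemma scales_volume_stretch:
  assumes a: "a \<in> euc m" "norm a = 1" and s: "s > -1"
  shows "scales_volume m (stretch a s) (1 + s)"
proof (cases m)
  case 0
  then show ?thesis using a by (auto simp: euc_0)
next
  case (Suc k)
  define w where "w = a - unit_seq k"
  have w: "w \<in> euc (Suc k)" using a by (auto simp: w_def Suc intro!: euc_arith)
  have wa: "reflection w a = unit_seq k"
    unfolding w_def by (rule reflection_swap) (simp add: a)
  have R: "scales_volume m (reflection w) 1"
    using scales_volume_reflection[OF w] by (simp add: Suc)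
  have "scales_volume (Suc k) (stretch (unit_seq k) s) (1 * \<bar>1 + s\<bar>)"
    using s by (intro scales_volume_fibre[OF scales_volume_id, of _ "\<lambda>_. 0"])
      (auto simp: stretch_def euc_def algebra_simps)
  then have U: "scales_volume m (stretch (unit_seq k) s) (1 + s)"
    using s by (simp add: Suc)
  have "scales_volume m (\<lambda>x. reflection w (stretch (unit_seq k) s (reflection w x))) (1 * ((1 + s) * 1))"
    by (rule scales_volume_comp[OF R scales_volume_comp[OF U R]])
  moreover have "reflection w (stretch (unit_seq k) s (reflection w x)) = stretch a s x" for x
  proof -
    have wk: "reflection w (unit_seq k) = a" using wa by (metis reflection_reflection)
    have i: "inner (unit_seq k) (reflection w x) = inner a x"
      by (metis inner_reflection wk)
    show ?thesis
      unfolding stretch_def i linear_add[OF linear_reflection] linear_scale[OF linear_reflection] wk by simp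
  qed
  ultimately show ?thesis by simp
qed

section \<open>Zonotopes and a lower bound for their volume\<close>

lemma compact_borel: "compact S \<Longrightarrow> S \<in> sets (borel :: fin_seq measure)"
  by (intro borel_closed compact_imp_closed)

lemma emeasure_leb_compact:
  assumes "compact S"
  shows "emeasure (leb m) S = ennreal (measure (leb m) S)"
proof -
  obtain r where r: "r > 0" "S \<subseteq> cball 0 r"
    using compact_imp_bounded[OF assms] bounded_pos[of S] by (auto simp: subset_iff)
  then have "emeasure (leb m) S \<le> emeasure (leb m) (cball 0 r)"
    by (intro emeasure_mono) auto
  also have "\<dots> < \<infinity>" using r by (simp add: emeasure_leb_cball)
  finally show ?thesis by (intro emeasure_eq_ennreal_measure) auto
qed

lemma measure_leb_mono:
  assumes "compact S" "compact R" "S \<subseteq> R"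
  shows "measure (leb m) S \<le> measure (leb m) R"
  using emeasure_mono[OF assms(3), of "leb m"] assms compact_borel[of R]
  by (simp add: emeasure_leb_compact)

lemma scales_volume_measure:
  assumes "scales_volume m T d" "compact S" "T -` S \<inter> euc m = R \<inter> euc m" "compact R"
  shows "measure (leb m) R * d = measure (leb m) S"
proof -
  have "T -` S \<in> sets borel"
    using measurable_sets[OF scales_volumeD(2)[OF assms(1)] compact_borel[OF assms(2)]] by simp
  then have "emeasure (leb m) R = emeasure (leb m) (T -` S)"
    using assms compact_borel[OF assms(4)] by (intro emeasure_leb_cong) auto
  then have "ennreal (measure (leb m) R) * ennreal d = ennreal (measure (leb m) S)"
    using scales_volume_emeasure[OF assms(1) compact_borel[OF assms(2)]] assms
    by (simp add: emeasure_leb_compact)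
  then show ?thesis
    using scales_volumeD(1)[OF assms(1)] by (simp add: ennreal_mult[symmetric])
qed

lemma measure_leb_cball: "r > 0 \<Longrightarrow> measure (leb m) (cball 0 r) = unit_ball_vol (real m) * r ^ m"
  by (simp add: measure_def emeasure_leb_cball)

definition truncate :: "nat \<Rightarrow> fin_seq \<Rightarrow> fin_seq" where
  "truncate m x = x - coord x m *\<^sub>R unit_seq m"

lemma linear_truncate: "linear (truncate m)"
  by (rule linearI) (auto simp: truncate_def algebra_simps)

lemma truncate_euc: "x \<in> euc (Suc m) \<Longrightarrow> truncate m x \<in> euc m"
  by (auto simp: truncate_def euc_def)

lemma continuous_on_truncate: "continuous_on S (truncate m)"
  unfolding truncate_def by (intro continuous_intros)

lemma norm_truncate_le: "norm (truncate m x) \<le> norm x"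
proof -
  have "inner (truncate m x) (truncate m x) = inner x x - coord x m * coord x m"
    by (simp only: truncate_def inner_diff_left inner_diff_right inner_scaleR_left
        inner_scaleR_right inner_unit_seq coord_unit_seq) simp
  moreover have "0 \<le> coord x m * coord x m" by simp
  ultimately show ?thesis unfolding norm_le by linarith
qed

definition thicken :: "fin_seq set \<Rightarrow> fin_seq \<Rightarrow> fin_seq set" where
  "thicken P v = (\<lambda>(p, s). p + s *\<^sub>R v) ` (P \<times> {-1..1})"

lemma compact_thicken: "compact P \<Longrightarrow> compact (thicken P v)"
  unfolding thicken_def case_prod_unfold
  by (intro compact_continuous_image compact_Times continuous_intros) auto

text \<open>Every nonempty fibre of \<open>P\<close> along the last axis is an interval and gets longer by \<open>2 * a\<close>; the
  nonempty fibres are those over the shadow of \<open>P\<close>.\<close>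

lemma measure_thicken_unit_seq:
  assumes P: "compact P" "convex P" "P \<subseteq> euc (Suc m)" and a: "a \<ge> 0"
  shows "measure (leb (Suc m)) P + 2 * a * measure (leb m) (truncate m ` P)
    \<le> measure (leb (Suc m)) (thicken P (a *\<^sub>R unit_seq m))"
proof -
  let ?Q = "thicken P (a *\<^sub>R unit_seq m)"
  have Q: "compact ?Q" using P by (intro compact_thicken)
  have tP: "compact (truncate m ` P)"
    using P by (intro compact_continuous_image continuous_on_truncate)
  note [measurable] = compact_borel[OF P(1)] compact_borel[OF Q] compact_borel[OF tP]
  define fib where "fib S x = {t. x + t *\<^sub>R unit_seq m \<in> S}" for S x
  have em: "emeasure (leb (Suc m)) S = (\<integral>\<^sup>+x. (\<integral>\<^sup>+t. indicator S (x + t *\<^sub>R unit_seq m) \<partial>lborel) \<partial>leb m)"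
    if [measurable]: "S \<in> sets borel" for S
    using nn_integral_leb_Suc[of "indicator S" m] that by simp
  have cfib: "compact (fib P x)" "convex (fib P x)" for x
  proof -
    have "continuous_on UNIV (\<lambda>t. x + t *\<^sub>R unit_seq m)" by (intro continuous_intros)
    then have "closed ((\<lambda>t. x + t *\<^sub>R unit_seq m) -` P)"
      by (rule closed_vimage[OF compact_imp_closed[OF P(1)]])
    then have "closed (fib P x)" by (simp add: fib_def vimage_def)
    moreover have "bounded (fib P x)"
    proof -
      obtain B where B: "\<And>y. y \<in> P \<Longrightarrow> norm y \<le> B"
        using compact_imp_bounded[OF P(1)] by (auto simp: bounded_iff)
      have "\<bar>t\<bar> \<le> B + norm x" if "t \<in> fib P x" for t
      proof -
        have "\<bar>t\<bar> = norm ((x + t *\<^sub>R unit_seq m) - x)" by simp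
        also have "\<dots> \<le> norm (x + t *\<^sub>R unit_seq m) + norm x" by (rule norm_triangle_ineq4)
        finally show ?thesis using B[of "x + t *\<^sub>R unit_seq m"] that by (simp add: fib_def)
      qed
      then show ?thesis by (auto simp: bounded_iff)
    qed
    ultimately show "compact (fib P x)" by (simp add: compact_eq_bounded_closed)
    have "u * s + v * t \<in> fib P x"
      if "s \<in> fib P x" "t \<in> fib P x" "0 \<le> u" "0 \<le> v" "u + v = 1" for s t u v
    proof -
      have "u *\<^sub>R (x + s *\<^sub>R unit_seq m) + v *\<^sub>R (x + t *\<^sub>R unit_seq m) \<in> P"
        using that by (intro convexD[OF P(2)]) (auto simp: fib_def)
      also have "u *\<^sub>R (x + s *\<^sub>R unit_seq m) + v *\<^sub>R (x + t *\<^sub>R unit_seq m)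
        = (u + v) *\<^sub>R x + (u * s + v * t) *\<^sub>R unit_seq m" by (simp add: algebra_simps)
      finally show ?thesis using that by (simp add: fib_def)
    qed
    then show "convex (fib P x)" by (auto simp: convex_def)
  qed
  have fibm: "(\<integral>\<^sup>+t. indicator S (x + t *\<^sub>R unit_seq m) \<partial>lborel) = emeasure lborel (fib S x)"
    if [measurable]: "S \<in> sets borel" for S x
  proof -
    have "fib S x \<in> sets borel" unfolding fib_def by measurable
    moreover have "indicator S (x + t *\<^sub>R unit_seq m) = (indicator (fib S x) t :: ennreal)" for t
      by (simp add: fib_def indicator_def)
    ultimately show ?thesis by simp
  qed
  have fibre_ineq: "emeasure lborel (fib P x) + ennreal (2 * a) * indicator (truncate m ` P) x
      \<le> emeasure lborel (fib ?Q x)" if x: "x \<in> euc m" for x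
  proof (cases "fib P x = {}")
    case True
    have "x \<notin> truncate m ` P"
    proof
      assume "x \<in> truncate m ` P"
      then obtain y where "y \<in> P" "x = y - coord y m *\<^sub>R unit_seq m" by (auto simp: truncate_def)
      then have "coord y m \<in> fib P x" by (simp add: fib_def)
      with True show False by simp
    qed
    with True show ?thesis by simp
  next
    case False
    obtain c d where cd: "fib P x = {c..d}"
      using connected_compact_interval_1[of "fib P x"] cfib[of x] convex_connected by auto
    with False have "c \<le> d" by auto
    have "{c - a..d + a} \<subseteq> fib ?Q x"
    proof
      fix t assume t: "t \<in> {c - a..d + a}"
      define r where "r = max c (min d t)"
      have r: "r \<in> fib P x" "\<bar>t - r\<bar> \<le> a"
        using t \<open>c \<le> d\<close> a unfolding cd r_def by (auto simp: max_def min_def abs_if)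
      have "x + t *\<^sub>R unit_seq m = (x + r *\<^sub>R unit_seq m) + ((t - r) / a) *\<^sub>R a *\<^sub>R unit_seq m"
      proof (cases "a = 0")
        case False
        then have "((t - r) / a) *\<^sub>R a *\<^sub>R unit_seq m = (t - r) *\<^sub>R unit_seq m" by simp
        then show ?thesis by (simp add: scaleR_left_diff_distrib)
      qed (use r in auto)
      moreover have "(t - r) / a \<in> {-1..1}"
        using r a by (cases "a = 0") (auto simp: field_simps abs_le_iff)
      ultimately show "t \<in> fib ?Q x"
        using r unfolding fib_def thicken_def
        by (intro CollectI image_eqI[of _ _ "(x + r *\<^sub>R unit_seq m, (t - r) / a)"]) auto
    qed
    moreover have "fib ?Q x \<in> sets borel"
      unfolding fib_def by measurable
    ultimately have "emeasure lborel {c - a..d + a} \<le> emeasure lborel (fib ?Q x)"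
      by (intro emeasure_mono) auto
    moreover have "emeasure lborel (fib P x) + ennreal (2 * a) * indicator (truncate m ` P) x
        \<le> emeasure lborel {c - a..d + a}"
    proof -
      have "emeasure lborel (fib P x) + ennreal (2 * a) * indicator (truncate m ` P) x
        \<le> ennreal (d - c) + ennreal (2 * a)"
        unfolding cd using \<open>c \<le> d\<close> by (intro add_mono) (auto simp: indicator_def)
      also have "\<dots> = ennreal (d + a - (c - a))"
        using \<open>c \<le> d\<close> a by (subst ennreal_plus[symmetric]) (auto simp: algebra_simps)
      also have "\<dots> = emeasure lborel {c - a..d + a}" using \<open>c \<le> d\<close> a by simp
      finally show ?thesis .
    qed
    ultimately show ?thesis by (rule order_trans[rotated])
  qed
  have "ennreal (measure (leb (Suc m)) P + 2 * a * measure (leb m) (truncate m ` P))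
      = emeasure (leb (Suc m)) P + ennreal (2 * a) * emeasure (leb m) (truncate m ` P)"
    using a by (simp add: emeasure_leb_compact P tP ennreal_mult)
  also have "\<dots> = (\<integral>\<^sup>+x. (\<integral>\<^sup>+t. indicator P (x + t *\<^sub>R unit_seq m) \<partial>lborel)
      + ennreal (2 * a) * indicator (truncate m ` P) x \<partial>leb m)"
    by (simp add: em nn_integral_add nn_integral_cmult)
  also have "\<dots> \<le> (\<integral>\<^sup>+x. (\<integral>\<^sup>+t. indicator ?Q (x + t *\<^sub>R unit_seq m) \<partial>lborel) \<partial>leb m)"
  proof (rule nn_integral_leb_mono)
    fix x assume "x \<in> euc m"
    from fibre_ineq[OF this]
    show "(\<integral>\<^sup>+t. indicator P (x + t *\<^sub>R unit_seq m) \<partial>lborel) + ennreal (2 * a) * indicator (truncate m ` P) x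
      \<le> (\<integral>\<^sup>+t. indicator ?Q (x + t *\<^sub>R unit_seq m) \<partial>lborel)" by (simp add: fibm)
  qed measurable
  also have "\<dots> = emeasure (leb (Suc m)) ?Q" by (simp add: em)
  also have "\<dots> = ennreal (measure (leb (Suc m)) ?Q)" by (simp add: emeasure_leb_compact Q)
  finally show ?thesis by simp
qed

lemma reflection_image: "reflection w ` S = reflection w -` S"
proof (intro equalityI subsetI)
  fix x assume "x \<in> reflection w -` S"
  then show "x \<in> reflection w ` S" by (intro image_eqI[of _ _ "reflection w x"]) auto
qed auto

lemma linear_thicken:
  assumes "linear T"
  shows "T ` thicken P v = thicken (T ` P) (T v)"
proof (intro equalityI subsetI)
  fix x assume "x \<in> T ` thicken P v"
  then obtain p s where "p \<in> P" "s \<in> {-1..1}" "x = T (p + s *\<^sub>R v)" by (auto simp: thicken_def)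
  then show "x \<in> thicken (T ` P) (T v)"
    unfolding thicken_def
    by (intro image_eqI[of _ _ "(T p, s)"]) (auto simp: linear_add[OF assms] linear_scale[OF assms])
next
  fix x assume "x \<in> thicken (T ` P) (T v)"
  then obtain p s where "p \<in> P" "s \<in> {-1..1}" "x = T (p + s *\<^sub>R v)"
    by (auto simp: thicken_def linear_add[OF assms] linear_scale[OF assms])
  then show "x \<in> T ` thicken P v"
    unfolding thicken_def by (intro image_eqI[of _ _ "p + s *\<^sub>R v"] image_eqI[of _ _ "(p, s)"]) auto
qed

text \<open>A reflection turns the direction of thickening into a coordinate direction, in which the fibres
  are intervals that all grow by the same length.\<close>

lemma measure_thicken:
  fixes v :: fin_seq
  assumes P: "compact P" "convex P" "P \<subseteq> euc (Suc m)" and v: "v \<in> euc (Suc m)"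
  defines "w \<equiv> v - norm v *\<^sub>R unit_seq m"
  shows "measure (leb (Suc m)) P + 2 * norm v * measure (leb m) (truncate m ` reflection w ` P)
    \<le> measure (leb (Suc m)) (thicken P v)"
proof -
  have w: "w \<in> euc (Suc m)" unfolding w_def using v by (intro euc_arith) auto
  have wv: "reflection w v = norm v *\<^sub>R unit_seq m"
    unfolding w_def by (rule reflection_swap) simp
  let ?P = "reflection w ` P"
  have R: "measure (leb (Suc m)) (reflection w ` S) = measure (leb (Suc m)) S" if "compact S" for S
    using scales_volume_measure[OF scales_volume_reflection[OF w] that, of "reflection w ` S"] that
    by (simp add: reflection_image[symmetric] compact_continuous_image continuous_on_reflection)
  have P': "compact ?P" "convex ?P" "?P \<subseteq> euc (Suc m)"
    using P w by (auto intro!: compact_continuous_image continuous_on_reflection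
        convex_linear_image linear_reflection reflection_euc)
  have "reflection w ` thicken P v = thicken ?P (norm v *\<^sub>R unit_seq m)"
    using linear_thicken[OF linear_reflection] by (simp add: wv)
  then have "measure (leb (Suc m)) (thicken P v) 
      = measure (leb (Suc m)) (thicken ?P (norm v *\<^sub>R unit_seq m))"
    using R[OF compact_thicken[OF P(1), of v]] by simp
  moreover have "measure (leb (Suc m)) P = measure (leb (Suc m)) ?P"
    using R[OF P(1)] by simp
  ultimately show ?thesis
    using measure_thicken_unit_seq[OF P', of "norm v"] by simp
qed

definition segment_sum :: "nat \<Rightarrow> (nat \<Rightarrow> fin_seq) \<Rightarrow> fin_seq set" where
  "segment_sum N v = {(\<Sum>i<N. t i *\<^sub>R v i) | t. \<forall>i<N. \<bar>t i\<bar> \<le> (1::real)}"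

lemma segment_sumI: "(\<And>i. i < N \<Longrightarrow> \<bar>t i\<bar> \<le> 1) \<Longrightarrow> (\<Sum>i<N. t i *\<^sub>R v i) \<in> segment_sum N v"
  unfolding segment_sum_def by blast

lemma segment_sum_Suc: "segment_sum (Suc N) v = thicken (segment_sum N v) (v N)"
proof (intro equalityI subsetI)
  fix x assume "x \<in> segment_sum (Suc N) v"
  then obtain t where t: "\<forall>i<Suc N. \<bar>t i\<bar> \<le> 1" "x = (\<Sum>i<Suc N. t i *\<^sub>R v i)"
    by (auto simp: segment_sum_def)
  from t(1) have "- 1 \<le> t N" "t N \<le> 1" by (auto simp: abs_le_iff)
  with t show "x \<in> thicken (segment_sum N v) (v N)"
    unfolding thicken_def
    by (intro image_eqI[of _ _ "(\<Sum>i<N. t i *\<^sub>R v i, t N)"]) (auto intro!: segment_sumI)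
next
  fix x assume "x \<in> thicken (segment_sum N v) (v N)"
  then obtain t s where t: "\<forall>i<N. \<bar>t i\<bar> \<le> 1" "- 1 \<le> s" "s \<le> 1" "x = (\<Sum>i<N. t i *\<^sub>R v i) + s *\<^sub>R v N"
    by (auto simp: thicken_def segment_sum_def)
  have "x = (\<Sum>i<Suc N. (t(N := s)) i *\<^sub>R v i)"
    using t by simp
  also have "\<dots> \<in> segment_sum (Suc N) v"
    using t by (intro segment_sumI) (auto simp: less_Suc_eq)
  finally show "x \<in> segment_sum (Suc N) v" .
qed

lemma segment_sum_0: "segment_sum 0 v = {0}"
  by (auto simp: segment_sum_def)

lemma compact_segment_sum: "compact (segment_sum N v)"
  by (induction N) (auto simp: segment_sum_0 segment_sum_Suc compact_thicken)

lemma convex_segment_sum: "convex (segment_sum N v)"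
proof (rule convexI)
  fix x y and a b :: real
  assume "x \<in> segment_sum N v" "y \<in> segment_sum N v" and ab: "0 \<le> a" "0 \<le> b" "a + b = 1"
  then obtain s t where s: "\<forall>i<N. \<bar>s i\<bar> \<le> 1" "x = (\<Sum>i<N. s i *\<^sub>R v i)"
    and t: "\<forall>i<N. \<bar>t i\<bar> \<le> 1" "y = (\<Sum>i<N. t i *\<^sub>R v i)"
    by (auto simp: segment_sum_def)
  have "a *\<^sub>R x + b *\<^sub>R y = (\<Sum>i<N. (a * s i + b * t i) *\<^sub>R v i)"
    by (simp add: s t scaleR_sum_right scaleR_left_distrib sum.distrib)
  also have "\<dots> \<in> segment_sum N v"
  proof (rule segment_sumI)
    fix i assume "i < N"
    have "\<bar>a * s i + b * t i\<bar> \<le> a * \<bar>s i\<bar> + b * \<bar>t i\<bar>"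
      using ab abs_triangle_ineq[of "a * s i" "b * t i"] by (simp add: abs_mult)
    also have "\<dots> \<le> a * 1 + b * 1"
      using s t ab \<open>i < N\<close> by (intro add_mono mult_left_mono) auto
    finally show "\<bar>a * s i + b * t i\<bar> \<le> 1" using ab by simp
  qed
  finally show "a *\<^sub>R x + b *\<^sub>R y \<in> segment_sum N v" .
qed

lemma segment_sum_euc: "(\<And>i. i < N \<Longrightarrow> v i \<in> euc m) \<Longrightarrow> segment_sum N v \<subseteq> euc m"
  by (auto simp: segment_sum_def intro!: euc_arith)

lemma linear_segment_sum:
  assumes "linear T"
  shows "T ` segment_sum N v = segment_sum N (\<lambda>i. T (v i))"
proof (induction N)
  case 0
  show ?case using assms by (simp add: segment_sum_0 linear_0)
next
  case (Suc N)
  then show ?case using assms by (simp add: segment_sum_Suc linear_thicken)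
qed

text \<open>The trace of the quadratic form, computed over the coordinate directions. It is the sum of the
  \<open>(norm (v i))\<^sup>2 / q i\<close>.\<close>

lemma sum_sq_div_le:
  fixes v :: "nat \<Rightarrow> fin_seq"
  assumes v: "\<And>i. i < N \<Longrightarrow> v i \<in> euc m" "\<And>i. i < N \<Longrightarrow> norm (v i) \<le> q i"
    and b: "\<And>x. x \<in> euc m \<Longrightarrow> b * (norm x)\<^sup>2 \<le> (\<Sum>i<N. (inner x (v i))\<^sup>2 / q i)"
  shows "b * m \<le> (\<Sum>i<N. norm (v i))"
proof -
  have "b * m = (\<Sum>k<m. b * (norm (unit_seq k))\<^sup>2)" by simp
  also have "\<dots> \<le> (\<Sum>k<m. \<Sum>i<N. (inner (unit_seq k) (v i))\<^sup>2 / q i)"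
    by (intro sum_mono b) simp
  also have "\<dots> = (\<Sum>i<N. (\<Sum>k<m. (coord (v i) k)\<^sup>2) / q i)"
    by (subst sum.swap) (simp add: sum_divide_distrib)
  also have "\<dots> = (\<Sum>i<N. (norm (v i))\<^sup>2 / q i)"
    by (intro sum.cong refl) (simp add: norm_euc[OF v(1)])
  also have "\<dots> \<le> (\<Sum>i<N. norm (v i))"
  proof (rule sum_mono)
    fix i assume i: "i \<in> {..<N}"
    show "(norm (v i))\<^sup>2 / q i \<le> norm (v i)"
    proof (cases "q i = 0")
      case False
      have "0 \<le> q i" using v(2)[of i] i norm_ge_zero[of "v i"] by (simp del: norm_ge_zero)
      with False have "q i > 0" by simp
      then show ?thesis
        using v(2)[of i] i by (simp add: divide_le_eq power2_eq_square mult_left_mono)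
    qed simp
  qed
  finally show ?thesis .
qed

text \<open>Dilating the zonotope by the factor \<open>1 + 1/m\<close> amounts to thickening it successively by
  \<open>v i / m\<close>. Each step gains the volume of a shadow, which is bounded below by induction on the
  dimension, since projections preserve the hypotheses: for this reason the weights
  \<open>q i\<close> are only required to dominate the lengths, which projections diminish. As \<open>(1 + 1/m)^m \<le> 3\<close>, the gain is at most
  twice the volume. The trace of the quadratic form bounds the total gain from below.\<close>

lemma volume_segment_sum_ge:
  assumes "\<And>i. i < N \<Longrightarrow> v i \<in> euc m" "\<And>i. i < N \<Longrightarrow> norm (v i) \<le> q i" and b0: "b \<ge> 0"
    and "\<And>x. x \<in> euc m \<Longrightarrow> b * (norm x)\<^sup>2 \<le> (\<Sum>i<N. (inner x (v i))\<^sup>2 / q i)"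
  shows "b ^ m \<le> measure (leb m) (segment_sum N v)"
  using assms(1,2,4)
proof (induction m arbitrary: v)
  case 0
  have "segment_sum N v \<subseteq> euc 0" using 0 by (intro segment_sum_euc)
  moreover have "segment_sum N v \<noteq> {}" using segment_sumI[of N "\<lambda>_. 0" v] by auto
  ultimately have "segment_sum N v = {0}" by (auto simp: euc_0)
  moreover have "measure (leb 0) {0} = measure (leb 0) (cball 0 1)"
    unfolding measure_def by (intro arg_cong[where f=enn2real] emeasure_leb_cong) (auto simp: euc_0)
  ultimately show ?case by (simp add: measure_leb_cball)
next
  case (Suc m)
  define \<epsilon> where "\<epsilon> = 1 / real (Suc m)"
  have \<epsilon>: "\<epsilon> > 0" by (simp add: \<epsilon>_def)
  define Z where "Z = segment_sum N v"
  define W where "W j = segment_sum N (\<lambda>i. (if i < j then 1 + \<epsilon> else 1) *\<^sub>R v i)" for j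
  have Weuc: "W j \<subseteq> euc (Suc m)" for j
    unfolding W_def using Suc.prems by (intro segment_sum_euc euc_arith) auto
  have Wc: "compact (W j)" "convex (W j)" for j
    unfolding W_def by (rule compact_segment_sum convex_segment_sum)+
  have ZW: "Z \<subseteq> W j" for j
  proof
    fix x assume "x \<in> Z"
    then obtain t where t: "\<forall>i<N. \<bar>t i\<bar> \<le> 1" "x = (\<Sum>i<N. t i *\<^sub>R v i)"
      by (auto simp: Z_def segment_sum_def)
    define c where "c i = (if i < j then 1 + \<epsilon> else 1)" for i
    have c: "c i \<ge> 1" for i using \<epsilon> by (auto simp: c_def)
    have "x = (\<Sum>i<N. (t i / c i) *\<^sub>R c i *\<^sub>R v i)"
      unfolding t(2)
    proof (intro sum.cong refl)
      fix i show "t i *\<^sub>R v i = (t i / c i) *\<^sub>R c i *\<^sub>R v i" using c[of i] by simp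
    qed
    also have "\<dots> \<in> W j"
      unfolding W_def c_def[symmetric]
    proof (rule segment_sumI)
      fix i assume "i < N"
      then have "\<bar>t i\<bar> \<le> 1 * c i" using t(1) c[of i] by force
      then show "\<bar>t i / c i\<bar> \<le> 1" using c[of i] by (simp add: divide_le_eq)
    qed
    finally show "x \<in> W j" .
  qed
  have step: "thicken (W j) (\<epsilon> *\<^sub>R v j) \<subseteq> W (Suc j)" if j: "j < N" for j
  proof
    fix x assume "x \<in> thicken (W j) (\<epsilon> *\<^sub>R v j)"
    then obtain t s where t: "\<forall>i<N. \<bar>t i\<bar> \<le> 1" and s: "- 1 \<le> s" "s \<le> 1"
      and x: "x = (\<Sum>i<N. t i *\<^sub>R (if i < j then 1 + \<epsilon> else 1) *\<^sub>R v i) + s *\<^sub>R \<epsilon> *\<^sub>R v j"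
      by (auto simp: thicken_def W_def segment_sum_def)
    define r where "r = (t j + s * \<epsilon>) / (1 + \<epsilon>)"
    have r: "r * (1 + \<epsilon>) = t j + s * \<epsilon>" using \<epsilon> by (simp add: r_def)
    have "\<bar>t j + s * \<epsilon>\<bar> \<le> \<bar>t j\<bar> + \<bar>s\<bar> * \<epsilon>"
      using abs_triangle_ineq[of "t j" "s * \<epsilon>"] \<epsilon> by (simp add: abs_mult)
    also have "\<dots> \<le> 1 + 1 * \<epsilon>"
      using t j s \<epsilon> by (intro add_mono mult_right_mono) (auto simp: abs_le_iff)
    finally have r1: "\<bar>r\<bar> \<le> 1" using \<epsilon> by (simp add: r_def abs_divide divide_le_eq)
    have "x = (\<Sum>i<N. (t(j := r)) i *\<^sub>R (if i < Suc j then 1 + \<epsilon> else 1) *\<^sub>R v i)"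
    proof -
      have eq: "(\<Sum>i\<in>{..<N} - {j}. (t i * (if i < j then 1 + \<epsilon> else 1)) *\<^sub>R v i)
        = (\<Sum>i\<in>{..<N} - {j}. (t i * (if i < Suc j then 1 + \<epsilon> else 1)) *\<^sub>R v i)"
        by (intro sum.cong refl) (auto simp: less_Suc_eq)
      have "r *\<^sub>R (1 + \<epsilon>) *\<^sub>R v j = t j *\<^sub>R v j + s *\<^sub>R \<epsilon> *\<^sub>R v j"
        unfolding scaleR_scaleR r by (rule scaleR_left_distrib)
      then show ?thesis
        unfolding x using j by (simp add: sum.remove[of "{..<N}" j] eq)
    qed
    also have "\<dots> \<in> W (Suc j)"
      unfolding W_def using t r1 by (intro segment_sumI) auto
    finally show "x \<in> W (Suc j)" .
  qed
  have shadow: "b ^ m \<le> measure (leb m) (truncate m ` reflection w ` W j)" if w: "w \<in> euc (Suc m)" for w j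
  proof -
    define u where "u i = truncate m (reflection w (v i))" for i
    have inn: "inner x (u i) = inner (reflection w x) (v i)" if "x \<in> euc m" for x i
    proof -
      have "coord x m = 0" using that by (simp add: euc_def)
      then have "inner x (u i) = inner x (reflection w (v i))"
        by (simp add: u_def truncate_def inner_diff_right)
      then show ?thesis by (simp add: inner_reflection)
    qed
    have "b ^ m \<le> measure (leb m) (segment_sum N u)"
    proof (rule Suc.IH)
      fix i assume i: "i < N"
      show "u i \<in> euc m"
        using Suc.prems(1)[OF i] w unfolding u_def by (intro truncate_euc reflection_euc)
      show "norm (u i) \<le> q i"
        using norm_truncate_le[of m "reflection w (v i)"] Suc.prems(2)[OF i] by (simp add: u_def)
    next
      fix x assume x: "x \<in> euc m"
      then have "reflection w x \<in> euc (Suc m)"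
        using w by (intro reflection_euc) (auto intro: euc_mono[of m])
      from Suc.prems(3)[OF this] show "b * (norm x)\<^sup>2 \<le> (\<Sum>i<N. (inner x (u i))\<^sup>2 / q i)"
        using x by (simp add: inn)
    qed
    also have "segment_sum N u = truncate m ` reflection w ` Z"
      by (simp add: Z_def u_def[abs_def] linear_segment_sum linear_reflection linear_truncate)
    also have "measure (leb m) \<dots> \<le> measure (leb m) (truncate m ` reflection w ` W j)"
      using ZW[of j] Wc compact_segment_sum[of N v]
      by (intro measure_leb_mono image_mono compact_continuous_image continuous_on_truncate
          continuous_on_reflection) (auto simp: Z_def)
    finally show ?thesis .
  qed
  have grow: "measure (leb (Suc m)) Z + (\<Sum>i<j. 2 * \<epsilon> * norm (v i) * b ^ m) \<le> measure (leb (Suc m)) (W j)"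
    if "j \<le> N" for j
    using that
  proof (induction j)
    case 0
    then show ?case using ZW[of 0] Wc compact_segment_sum[of N v]
      by (auto intro!: measure_leb_mono simp: Z_def)
  next
    case (Suc j)
    let ?v = "\<epsilon> *\<^sub>R v j"
    define w where "w = ?v - norm ?v *\<^sub>R unit_seq m"
    have vj: "?v \<in> euc (Suc m)" using Suc.prems \<open>\<And>i. i < N \<Longrightarrow> v i \<in> euc (Suc m)\<close> by (intro euc_arith) auto
    have w: "w \<in> euc (Suc m)" unfolding w_def
      by (rule subspace_diff[OF subspace_euc vj]) (auto intro!: euc_arith)
    have "measure (leb (Suc m)) (W j) + 2 * norm ?v * b ^ m
        \<le> measure (leb (Suc m)) (W j) + 2 * norm ?v * measure (leb m) (truncate m ` reflection w ` W j)"
      by (intro add_left_mono mult_left_mono shadow w) auto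
    also have "\<dots> \<le> measure (leb (Suc m)) (thicken (W j) ?v)"
      unfolding w_def by (rule measure_thicken[OF Wc Weuc vj])
    also have "\<dots> \<le> measure (leb (Suc m)) (W (Suc j))"
      using Suc.prems by (intro measure_leb_mono compact_thicken Wc step) auto
    finally have "measure (leb (Suc m)) (W j) + 2 * norm ?v * b ^ m \<le> measure (leb (Suc m)) (W (Suc j))" .
    then show ?case using Suc.IH Suc.prems \<epsilon> by simp
  qed
  have "W N = (\<lambda>x. (1 + \<epsilon>) *\<^sub>R x) ` Z"
  proof -
    have "linear (\<lambda>x::fin_seq. (1 + \<epsilon>) *\<^sub>R x)" by (rule linear_scaleR)
    from linear_segment_sum[OF this, of N v] show ?thesis
      by (simp add: W_def Z_def segment_sum_def)
  qed
  then have "(\<lambda>x. (1 + \<epsilon>) *\<^sub>R x) -` W N = Z" using \<epsilon> by auto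
  then have "measure (leb (Suc m)) Z * (1 + \<epsilon>) ^ Suc m = measure (leb (Suc m)) (W N)"
    using \<epsilon> Wc compact_segment_sum[of N v]
    by (intro scales_volume_measure[OF scales_volume_scaleR]) (auto simp: Z_def)
  with grow[of N] have "measure (leb (Suc m)) Z + 2 * (\<epsilon> * (\<Sum>i<N. norm (v i)) * b ^ m)
      \<le> measure (leb (Suc m)) Z * (1 + \<epsilon>) ^ Suc m"
    by (simp add: sum_distrib_left sum_distrib_right mult_ac)
  also have "\<dots> \<le> measure (leb (Suc m)) Z * 3"
  proof (rule mult_left_mono)
    have "(1 + \<epsilon>) ^ Suc m \<le> exp \<epsilon> ^ Suc m" using \<epsilon> by (intro power_mono exp_ge_add_one_self) auto
    also have "\<dots> = exp 1" by (simp add: exp_of_nat_mult[symmetric] \<epsilon>_def del: power_Suc)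
    finally show "(1 + \<epsilon>) ^ Suc m \<le> 3" using exp_le by simp
  qed simp
  finally have "\<epsilon> * (\<Sum>i<N. norm (v i)) * b ^ m \<le> measure (leb (Suc m)) Z" by simp
  moreover have "b * b ^ m \<le> \<epsilon> * (\<Sum>i<N. norm (v i)) * b ^ m"
  proof (rule mult_right_mono)
    have "\<epsilon> * (b * real (Suc m)) \<le> \<epsilon> * (\<Sum>i<N. norm (v i))"
      using \<epsilon> by (intro mult_left_mono sum_sq_div_le[OF Suc.prems]) auto
    then show "b \<le> \<epsilon> * (\<Sum>i<N. norm (v i))" by (simp add: \<epsilon>_def)
  qed (simp add: b0)
  ultimately show ?case by (simp add: Z_def)
qed

section \<open>Linear images of a zonotope in almost minimal position\<close>

text \<open>\<open>T'\<close> is the inverse of the adjoint of \<open>T\<close> on \<open>euc m\<close>, so it transforms functionals when \<open>T\<close>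
  transforms vectors. It is carried along, as is \<open>d\<close>, because both are explicit for stretches, whereas
  adjoints, inverses and determinants would have to be constructed otherwise.\<close>

definition lin_change :: "nat \<Rightarrow> (fin_seq \<Rightarrow> fin_seq) \<Rightarrow> (fin_seq \<Rightarrow> fin_seq) \<Rightarrow> real \<Rightarrow> bool" where
  "lin_change m T T' d \<longleftrightarrow> linear T \<and> linear T' \<and> T ` euc m \<subseteq> euc m \<and> T' ` euc m = euc m \<and>
    (\<forall>x\<in>euc m. \<forall>y\<in>euc m. inner (T x) (T' y) = inner x y) \<and>
    scales_volume m T d \<and> scales_volume m T' (1 / d)"

lemma lin_changeD:
  assumes "lin_change m T T' d"
  shows "linear T" "linear T'" "x \<in> euc m \<Longrightarrow> T x \<in> euc m" "T' ` euc m = euc m"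
    "x \<in> euc m \<Longrightarrow> y \<in> euc m \<Longrightarrow> inner (T x) (T' y) = inner x y"
    "scales_volume m T d" "scales_volume m T' (1 / d)" "d > 0"
  using assms by (auto simp: lin_change_def scales_volume_def)

lemma lin_change_id: "lin_change m (\<lambda>x. x) (\<lambda>x. x) 1"
  by (auto simp: lin_change_def linear_ident scales_volume_id)

lemma lin_change_stretch:
  assumes T: "lin_change m T T' d" and a: "a \<in> euc m" "norm a = 1" and s: "s > -1"
  shows "lin_change m (\<lambda>x. stretch a s (T x)) (\<lambda>x. stretch a (1 / (1 + s) - 1) (T' x)) ((1 + s) * d)"
proof -
  define s' where "s' = 1 / (1 + s) - 1"
  have s': "s' > -1" "1 / (1 + s') - 1 = s" "1 + s' = 1 / (1 + s)" using s by (auto simp: s'_def)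
  have inv: "stretch a s (stretch a s' x) = x" "stretch a s' (stretch a s x) = x" for x
    using stretch_stretch[OF a(2) s, of x] stretch_stretch[OF a(2) s'(1), of x]
    by (simp_all add: s'(2) flip: s'_def)
  note TD = lin_changeD[OF T]
  have "linear (stretch a s \<circ> T)" "linear (stretch a s' \<circ> T')"
    using TD by (auto intro!: linear_compose linear_stretch)
  moreover have "(\<lambda>x. stretch a s (T x)) ` euc m \<subseteq> euc m"
    using TD a by (auto intro!: stretch_euc)
  moreover have "(\<lambda>x. stretch a s' (T' x)) ` euc m = euc m"
  proof -
    have "stretch a s' ` euc m = euc m"
    proof (intro equalityI subsetI)
      fix x assume "x \<in> euc m"
      then show "x \<in> stretch a s' ` euc m"
        using a by (intro image_eqI[of _ _ "stretch a s x"]) (auto simp: inv intro!: stretch_euc)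
    qed (use a in \<open>auto intro!: stretch_euc\<close>)
    then show ?thesis using TD(4) by (simp flip: image_image)
  qed
  moreover have "inner (stretch a s (T x)) (stretch a s' (T' y)) = inner x y"
    if "x \<in> euc m" "y \<in> euc m" for x y
    using TD(5)[OF that] by (simp add: inner_stretch inv)
  moreover have "scales_volume m (\<lambda>x. stretch a s (T x)) ((1 + s) * d)"
    by (rule scales_volume_comp[OF scales_volume_stretch[OF a s] TD(6)])
  moreover have "scales_volume m (\<lambda>x. stretch a s' (T' x)) (1 / ((1 + s) * d))"
    using scales_volume_comp[OF scales_volume_stretch[OF a s'(1)] TD(7)] by (simp add: s'(3))
  ultimately show ?thesis
    unfolding lin_change_def s'_def[symmetric] by (auto simp: comp_def)
qed

lemma measure_lin_change:
  assumes T: "lin_change m T T' d" and P: "compact P" "P \<subseteq> euc m" "compact (T ` P)"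
  shows "measure (leb m) (T ` P) = d * measure (leb m) P"
proof -
  note TD = lin_changeD[OF T]
  have inj: "x = y" if "x \<in> euc m" "y \<in> euc m" "T x = T y" for x y
  proof -
    have xy: "x - y \<in> euc m" using that by (intro euc_arith)
    have "inner (T (x - y)) (T' (x - y)) = 0" using that by (simp add: linear_diff[OF TD(1)])
    then show ?thesis using TD(5)[OF xy xy] by simp
  qed
  have "T -` (T ` P) \<inter> euc m = P \<inter> euc m"
  proof (intro equalityI subsetI)
    fix x assume "x \<in> T -` (T ` P) \<inter> euc m"
    then obtain y where "y \<in> P" "T x = T y" "x \<in> euc m" by auto
    with inj[of x y] P show "x \<in> P \<inter> euc m" by auto
  qed auto
  from scales_volume_measure[OF TD(6) P(3) this P(1)] show ?thesis by (simp add: mult.commute)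
qed

text \<open>The square of the left-hand side is the first two terms of the square of the right-hand side,
  that is \<open>sqrt (A\<^sup>2 + 2 * e) \<le> A + e / A\<close>. The bound is useful for both signs of \<open>s\<close>.\<close>

lemma norm_stretch_le:
  assumes a: "norm a = 1" and s: "s > -1"
  shows "norm (stretch a s y) \<le> norm y + (s + s\<^sup>2 / 2) * ((inner a y)\<^sup>2 / norm y)"
proof (cases "y = 0")
  case True
  then show ?thesis by (simp add: stretch_def)
next
  case False
  define c where "c = (inner a y)\<^sup>2"
  define r where "r = norm y"
  have r: "r > 0" using False by (simp add: r_def)
  have c: "0 \<le> c" "c \<le> r\<^sup>2"
    using Cauchy_Schwarz_ineq[of a y] a by (auto simp: c_def r_def simp flip: power2_norm_eq_inner)
  define e where "e = (s + s\<^sup>2 / 2) * c"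
  have "- (1 / 2) \<le> s + s\<^sup>2 / 2"
    using zero_le_power2[of "s + 1"] by (simp add: power2_eq_square algebra_simps)
  then have "- (1 / 2) * c \<le> e" unfolding e_def using c by (intro mult_right_mono)
  then have e: "- (r\<^sup>2) \<le> e" using c by simp
  have aa: "inner a a = 1" using a by (simp add: norm_eq_sqrt_inner)
  have "(norm (stretch a s y))\<^sup>2 = inner (stretch a s y) (stretch a s y)"
    by (rule power2_norm_eq_inner)
  also have "\<dots> = inner y y + 2 * (s * inner a y) * inner a y + (s * inner a y)\<^sup>2 * inner a a"
    unfolding stretch_def inner_add_left inner_add_right inner_scaleR_left inner_scaleR_right
    by (simp only: inner_commute[of y a]) (simp only: power2_eq_square algebra_simps)
  also have "\<dots> = r\<^sup>2 + 2 * e"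
    unfolding aa r_def power2_norm_eq_inner e_def c_def by (simp add: power2_eq_square algebra_simps del: dot_square_norm)
  also have "\<dots> \<le> (r + e / r)\<^sup>2"
    using r by (simp add: power2_eq_square field_simps)
  finally have "norm (stretch a s y) \<le> r + e / r"
  proof (rule power2_le_imp_le)
    show "0 \<le> r + e / r" using e r by (simp add: power2_eq_square field_simps)
  qed
  then show ?thesis by (simp add: r_def e_def c_def)
qed

text \<open>The linear image of the zonotope lies in the ball of radius \<open>\<Sum>i<N. norm (T (v i))\<close>. This is
  what keeps the functional minimised below away from 0.\<close>

lemma lin_change_sum_pow_ge:
  assumes T: "lin_change m T T' d" and v: "\<And>i. i < N \<Longrightarrow> v i \<in> euc m"
  shows "d * measure (leb m) (segment_sum N v) \<le> unit_ball_vol m * (\<Sum>i<N. norm (T (v i))) ^ m"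
proof -
  note TD = lin_changeD[OF T]
  define S where "S = (\<Sum>i<N. norm (T (v i)))"
  have S: "S \<ge> 0" by (simp add: S_def sum_nonneg)
  let ?P = "segment_sum N (\<lambda>i. T (v i))"
  have vol: "d * measure (leb m) (segment_sum N v) = measure (leb m) ?P"
    using measure_lin_change[OF T, of "segment_sum N v"] v
    by (simp add: linear_segment_sum[OF TD(1)] compact_segment_sum segment_sum_euc)
  have nrm: "norm x \<le> S" if "x \<in> ?P" for x
  proof -
    obtain t where t: "\<forall>i<N. \<bar>t i\<bar> \<le> 1" "x = (\<Sum>i<N. t i *\<^sub>R T (v i))"
      using \<open>x \<in> ?P\<close> by (auto simp: segment_sum_def)
    have "norm x \<le> (\<Sum>i<N. \<bar>t i\<bar> * norm (T (v i)))"
      unfolding t(2) by (rule order_trans[OF norm_sum]) simp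
    also have "\<dots> \<le> (\<Sum>i<N. 1 * norm (T (v i)))"
      using t(1) by (intro sum_mono mult_right_mono) auto
    finally show ?thesis by (simp add: S_def)
  qed
  have "measure (leb m) ?P \<le> unit_ball_vol m * (S + e) ^ m" if "e > 0" for e
  proof -
    have *: "?P \<subseteq> cball 0 (S + e)" using nrm that by force
    have "emeasure (leb m) ?P \<le> emeasure (leb m) (cball 0 (S + e))"
      using * by (intro emeasure_mono) auto
    then show ?thesis
      using S that by (simp add: emeasure_leb_cball emeasure_leb_compact[OF compact_segment_sum])
  qed
  moreover have "((\<lambda>e. unit_ball_vol m * (S + e) ^ m) \<longlongrightarrow> unit_ball_vol m * (S + 0) ^ m) (at_right 0)"
    by (intro tendsto_intros)
  ultimately have "measure (leb m) ?P \<le> unit_ball_vol m * (S + 0) ^ m"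
    by (intro tendsto_lowerbound[of _ _ "at_right 0"]) (auto simp: eventually_at_filter)
  then show ?thesis by (simp add: vol S_def)
qed

text \<open>The functional is compared with its infimum up to the factor \<open>11 / 10\<close>, since then no compactness
  argument is needed; the loss only affects constants.\<close>

lemma almost_minimal_position:
  assumes v: "\<And>i. i < N \<Longrightarrow> v i \<in> euc m" and pos: "measure (leb m) (segment_sum N v) > 0" and m: "m > 0"
  obtains T T' d where "lin_change m T T' d" "(\<Sum>i<N. norm (T (v i))) > 0"
    "\<And>U U' e. lin_change m U U' e \<Longrightarrow>
      (\<Sum>i<N. norm (T (v i))) ^ m / d \<le> 11 / 10 * ((\<Sum>i<N. norm (U (v i))) ^ m / e)"
proof -
  define V where "V = measure (leb m) (segment_sum N v)"
  define A where "A = {(\<Sum>i<N. norm (T (v i))) ^ m / d | T T' d. lin_change m T T' d}"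
  have lb: "V / unit_ball_vol m \<le> x" if xA: "x \<in> A" for x
  proof -
    obtain T T' d where T: "lin_change m T T' d" and x: "x = (\<Sum>i<N. norm (T (v i))) ^ m / d"
      using xA unfolding A_def by blast
    from lin_change_sum_pow_ge[OF T v] lin_changeD(8)[OF T] show ?thesis
      unfolding x V_def by (simp add: field_simps)
  qed
  have V: "V / unit_ball_vol m > 0" using pos by (simp add: V_def)
  have A0: "A \<noteq> {}" using lin_change_id by (auto simp: A_def)
  have bdd: "bdd_below A" using lb by (auto simp: bdd_below_def)
  have I: "Inf A > 0" using cInf_greatest[OF A0 lb] V by simp
  then have "Inf A < 11 / 10 * Inf A" by simp
  then obtain x where x: "x \<in> A" "x < 11 / 10 * Inf A"
    using cInf_lessD[OF A0] by blast
  obtain T T' d where T: "lin_change m T T' d" and xT: "x = (\<Sum>i<N. norm (T (v i))) ^ m / d"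
    using x(1) unfolding A_def by blast
  show ?thesis
  proof (rule that[OF T])
    have "x > 0" using lb[OF x(1)] V by simp
    then have "(\<Sum>i<N. norm (T (v i))) \<noteq> 0" using m by (auto simp: xT zero_power)
    then show "(\<Sum>i<N. norm (T (v i))) > 0" by (simp add: less_le sum_nonneg)
    fix U U' e assume "lin_change m U U' e"
    then have "(\<Sum>i<N. norm (U (v i))) ^ m / e \<in> A" by (auto simp: A_def)
    then have "Inf A \<le> (\<Sum>i<N. norm (U (v i))) ^ m / e" using bdd by (rule cInf_lower)
    with x(2) show "(\<Sum>i<N. norm (T (v i))) ^ m / d \<le> 11 / 10 * ((\<Sum>i<N. norm (U (v i))) ^ m / e)"
      unfolding xT by linarith
  qed
qed

text \<open>Stretching by \<open>1 + s\<close> in the direction \<open>a\<close> multiplies the volume factor by \<open>1 + s\<close> and the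
  sum of the lengths by at most \<open>1 + (s + s\<^sup>2 / 2) * p / m\<close>, where \<open>p\<close> is the normalised value
  at \<open>a\<close> of the quadratic form. Minimality then bounds \<open>p\<close> from below when \<open>s > 0\<close> and from above
  when \<open>s < 0\<close>. At an exact minimum, \<open>s \<rightarrow> 0\<close> would give \<open>p = 1\<close>.\<close>

lemma balanced_position:
  assumes v: "\<And>i. i < N \<Longrightarrow> v i \<in> euc m" and pos: "measure (leb m) (segment_sum N v) > 0" and m: "m > 0"
  obtains T T' d S where "lin_change m T T' d" "S = (\<Sum>i<N. norm (T (v i)))" "S > 0"
    "\<And>x. x \<in> euc m \<Longrightarrow> S / (4 * m) * (norm x)\<^sup>2 \<le> (\<Sum>i<N. (inner x (T (v i)))\<^sup>2 / norm (T (v i)))"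
    "\<And>x. x \<in> euc m \<Longrightarrow> (\<Sum>i<N. (inner x (T (v i)))\<^sup>2 / norm (T (v i))) \<le> 3 * S / m * (norm x)\<^sup>2"
proof -
  obtain T T' d where T: "lin_change m T T' d" and S0: "(\<Sum>i<N. norm (T (v i))) > 0" and
    min: "\<And>U U' e. lin_change m U U' e \<Longrightarrow>
      (\<Sum>i<N. norm (T (v i))) ^ m / d \<le> 11 / 10 * ((\<Sum>i<N. norm (U (v i))) ^ m / e)"
    using almost_minimal_position[OF assms] by blast
  define S where "S = (\<Sum>i<N. norm (T (v i)))"
  have S: "S > 0" using S0 by (simp add: S_def)
  have d: "d > 0" using lin_changeD(8)[OF T] .
  define b where "b x = (\<Sum>i<N. (inner x (T (v i)))\<^sup>2 / norm (T (v i)))" for x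
  have key: "1 + s \<le> 11 / 10 * exp ((s + s\<^sup>2 / 2) * (m * b a / S))"
    if a: "a \<in> euc m" "norm a = 1" and s: "s > -1" for a s
  proof -
    define S2 where "S2 = (\<Sum>i<N. norm (stretch a s (T (v i))))"
    define z where "z = (s + s\<^sup>2 / 2) * (b a / S)"
    have "S2 \<le> (\<Sum>i<N. norm (T (v i)) + (s + s\<^sup>2 / 2) * ((inner a (T (v i)))\<^sup>2 / norm (T (v i))))"
      unfolding S2_def by (intro sum_mono norm_stretch_le a s)
    also have "\<dots> = S + (s + s\<^sup>2 / 2) * b a"
      by (simp add: sum.distrib S_def b_def sum_distrib_left)
    also have "\<dots> = S * (1 + z)" using S by (simp add: z_def field_simps)
    also have "\<dots> \<le> S * exp z" using S by (intro mult_left_mono exp_ge_add_one_self) auto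
    finally have "S2 ^ m \<le> (S * exp z) ^ m"
      by (intro power_mono) (auto simp: S2_def sum_nonneg)
    also have "\<dots> = S ^ m * exp (m * z)" by (simp add: power_mult_distrib exp_of_nat_mult)
    finally have S2: "S2 ^ m \<le> S ^ m * exp (m * z)" .
    have "S ^ m / d \<le> 11 / 10 * (S2 ^ m / ((1 + s) * d))"
      using min[OF lin_change_stretch[OF T a s]] by (simp add: S_def S2_def)
    then have "S ^ m / d * ((1 + s) * d) \<le> 11 / 10 * (S2 ^ m / ((1 + s) * d)) * ((1 + s) * d)"
      using d s by (intro mult_right_mono) auto
    then have "S ^ m * (1 + s) \<le> 11 / 10 * S2 ^ m" using d s by simp
    also have "\<dots> \<le> 11 / 10 * (S ^ m * exp (m * z))" using S2 by simp
    also have "\<dots> = S ^ m * (11 / 10 * exp (m * z))" by simp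
    finally have "1 + s \<le> 11 / 10 * exp (m * z)"
      by (rule mult_left_le_imp_le) (use S in simp)
    then show ?thesis by (simp add: z_def mult_ac)
  qed
  have unit: "1 / 4 \<le> m * b a / S" "m * b a / S \<le> 3" if a: "a \<in> euc m" "norm a = 1" for a
  proof -
    define p where "p = m * b a / S"
    have b0: "b a \<ge> 0" unfolding b_def by (intro sum_nonneg) auto
    have p0: "p \<ge> 0" using S b0 by (simp add: p_def)
    \<comment> \<open>Stretching by the factor 2.\<close>
    show "1 / 4 \<le> m * b a / S"
    proof (rule ccontr)
      assume "\<not> 1 / 4 \<le> m * b a / S"
      then have "p < 1 / 4" by (simp add: p_def)
      then have "exp (3 / 2 * p) \<le> exp (3 / 8)" by simp
      also have "\<dots> \<le> 1 + 3 / 8 + (3 / 8)\<^sup>2" by (rule exp_bound) auto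
      finally have "11 / 10 * exp (3 / 2 * p) < 2" by (simp add: power2_eq_square)
      with key[OF a, of 1] show False by (simp add: p_def)
    qed
    \<comment> \<open>Shrinking by the factor 2.\<close>
    show "m * b a / S \<le> 3"
    proof (rule ccontr)
      assume "\<not> m * b a / S \<le> 3"
      then have p: "p > 3" by (simp add: p_def)
      have "(25 / 16)\<^sup>2 \<le> (1 + 3 * p / 16)\<^sup>2" using p by (intro power_mono) auto
      also have "\<dots> \<le> (exp (3 * p / 16))\<^sup>2" using p by (intro power_mono exp_ge_add_one_self) auto
      also have "\<dots> = exp (3 * p / 8)" by (simp add: exp_of_nat_mult[symmetric] flip: exp_double)
      finally have e: "(25 / 16)\<^sup>2 \<le> exp (3 * p / 8)" .
      have "1 / 2 \<le> 11 / 10 * exp (- (3 * p / 8))"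
        using key[OF a, of "- (1 / 2)"] by (simp add: p_def power2_eq_square mult.commute[of S])
      then have "1 / 2 * exp (3 * p / 8) \<le> 11 / 10 * (exp (- (3 * p / 8)) * exp (3 * p / 8))" by simp
      then have "1 / 2 * exp (3 * p / 8) \<le> 11 / 10" by (simp flip: exp_add)
      with e show False by (simp add: power2_eq_square)
    qed
  qed
  have hom: "b x = b ((1 / norm x) *\<^sub>R x) * (norm x)\<^sup>2" if "x \<noteq> 0" for x
    using that by (simp add: b_def sum_distrib_right power_mult_distrib power_divide)
  have bounds: "S / (4 * m) * (norm x)\<^sup>2 \<le> b x \<and> b x \<le> 3 * S / m * (norm x)\<^sup>2" if x: "x \<in> euc m" for x
  proof (cases "x = 0")
    case False
    let ?a = "(1 / norm x) *\<^sub>R x"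
    have a: "?a \<in> euc m" "norm ?a = 1" using x False by (auto intro!: euc_arith)
    have "S / (4 * m) \<le> b ?a" "b ?a \<le> 3 * S / m"
      using unit[OF a] m S by (simp_all add: field_simps)
    then show ?thesis
      unfolding hom[OF False] by (intro conjI mult_right_mono) auto
  qed (simp add: b_def)
  show ?thesis
    by (rule that[OF T S_def S]) (use bounds in \<open>auto simp: b_def\<close>)
qed

lemma sum_abs_inner_sq_le:
  fixes u :: "nat \<Rightarrow> 'a::real_inner"
  shows "(\<Sum>i<N. \<bar>inner y (u i)\<bar>)\<^sup>2 \<le> (\<Sum>i<N. norm (u i)) * (\<Sum>i<N. (inner y (u i))\<^sup>2 / norm (u i))"
proof -
  have "(\<Sum>i<N. \<bar>inner y (u i)\<bar>)\<^sup>2 = (\<Sum>i<N. sqrt (norm (u i)) * (\<bar>inner y (u i)\<bar> / sqrt (norm (u i))))\<^sup>2"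
    by (intro arg_cong[where f="\<lambda>x. x\<^sup>2"] sum.cong refl) simp
  also have "\<dots> \<le> (\<Sum>i<N. (sqrt (norm (u i)))\<^sup>2) * (\<Sum>i<N. (\<bar>inner y (u i)\<bar> / sqrt (norm (u i)))\<^sup>2)"
    by (rule Cauchy_Schwarz_ineq_sum)
  also have "\<dots> = (\<Sum>i<N. norm (u i)) * (\<Sum>i<N. (inner y (u i))\<^sup>2 / norm (u i))"
    by (simp add: power_divide)
  finally show ?thesis .
qed

lemma sum_abs_inner_le:
  fixes u :: "nat \<Rightarrow> 'a::real_inner"
  assumes "(\<Sum>i<N. (inner y (u i))\<^sup>2 / norm (u i)) \<le> 3 * S / m * (norm y)\<^sup>2"
    and S: "S = (\<Sum>i<N. norm (u i))"
  shows "(\<Sum>i<N. \<bar>inner y (u i)\<bar>) \<le> S * sqrt (3 / real m) * norm y"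
proof -
  have S0: "S \<ge> 0" unfolding S by (simp add: sum_nonneg)
  have "(\<Sum>i<N. \<bar>inner y (u i)\<bar>)\<^sup>2 \<le> S * (\<Sum>i<N. (inner y (u i))\<^sup>2 / norm (u i))"
    unfolding S by (rule sum_abs_inner_sq_le)
  also have "\<dots> \<le> S * (3 * S / m * (norm y)\<^sup>2)"
    using S0 assms(1) by (intro mult_left_mono)
  also have "\<dots> = (S * sqrt (3 / m) * norm y)\<^sup>2"
    by (simp add: power_mult_distrib) (simp add: power2_eq_square)
  finally show ?thesis by (rule power2_le_imp_le) (use S0 in simp)
qed

section \<open>The symplectic form\<close>

text \<open>The standard complex structure \<open>(x\<^sub>j, y\<^sub>j) \<mapsto> (- y\<^sub>j, x\<^sub>j)\<close> of the first \<open>n\<close> coordinate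
  planes. The rotation of each plane is written as a product of two reflections, so that it evidently
  is an isometry and preserves volume.\<close>

fun quarter_turn :: "nat \<Rightarrow> fin_seq \<Rightarrow> fin_seq" where
  "quarter_turn 0 x = x"
| "quarter_turn (Suc n) x = reflection (unit_seq (2 * n))
     (reflection (unit_seq (2 * n) - unit_seq (2 * n + 1)) (quarter_turn n x))"

lemma scales_volume_quarter_turn: "2 * n \<le> m \<Longrightarrow> scales_volume m (quarter_turn n) 1"
proof (induction n)
  case (Suc n)
  have "scales_volume m (reflection (unit_seq (2 * n))) 1"
    "scales_volume m (reflection (unit_seq (2 * n) - unit_seq (2 * n + 1))) 1"
    using Suc.prems by (auto intro!: scales_volume_reflection euc_arith)
  from scales_volume_comp[OF this(1) scales_volume_comp[OF this(2) Suc.IH]] Suc.prems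
  show ?case by simp
next
  case 0
  have "quarter_turn 0 = (\<lambda>x. x)" by (rule ext) simp
  then show ?case by (simp only: scales_volume_id)
qed

lemma quarter_turn_euc: "2 * n \<le> m \<Longrightarrow> x \<in> euc m \<Longrightarrow> quarter_turn n x \<in> euc m"
  by (induction n) (auto intro!: reflection_euc euc_arith)

lemma inner_quarter_turn: "inner (quarter_turn n x) (quarter_turn n y) = inner x y"
  by (induction n) (auto simp: inner_reflection)

lemma coord_quarter_turn_ge: "2 * n \<le> i \<Longrightarrow> coord (quarter_turn n x) i = coord x i"
  by (induction n) (auto simp: reflection_def)

lemma coord_quarter_turn:
  "j < n \<Longrightarrow> coord (quarter_turn n x) (2 * j) = - coord x (2 * j + 1) \<and>
    coord (quarter_turn n x) (2 * j + 1) = coord x (2 * j)"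
proof (induction n)
  case (Suc n)
  define y where "y = quarter_turn n x"
  have w: "inner (unit_seq (2 * n) - unit_seq (2 * n + 1)) (unit_seq (2 * n) - unit_seq (2 * n + 1)) = 2"
    by (simp add: inner_diff_left)
  have r: "reflection (unit_seq (2 * n) - unit_seq (2 * n + 1)) y
      = y - (coord y (2 * n) - coord y (2 * n + 1)) *\<^sub>R (unit_seq (2 * n) - unit_seq (2 * n + 1))"
    unfolding reflection_def w by (simp add: inner_diff_left)
  show ?case
  proof (cases "j = n")
    case True
    have "coord y (2 * n) = coord x (2 * n)" "coord y (2 * n + 1) = coord x (2 * n + 1)"
      unfolding y_def by (intro coord_quarter_turn_ge; simp)+
    then show ?thesis
      unfolding quarter_turn.simps y_def[symmetric] r by (simp add: True reflection_def)
  next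
    case False
    then have "j < n" "2 * j \<noteq> 2 * n" "2 * j + 1 \<noteq> 2 * n" "2 * j \<noteq> 2 * n + 1" "2 * j + 1 \<noteq> 2 * n + 1"
      using Suc.prems by presburger+
    with Suc.IH show ?thesis
      unfolding quarter_turn.simps y_def[symmetric] r by (simp add: reflection_def)
  qed
qed simp

lemma sum_lessThan_double: "(\<Sum>i<2 * n. f i) = (\<Sum>j<n. f (2 * j) + f (2 * j + 1))"
  for f :: "nat \<Rightarrow> real"
  by (induction n) auto

lemma omega_st_eq_inner:
  assumes "u \<in> euc (2 * n)"
  shows "omega_st n u v = inner (quarter_turn n u) v"
proof -
  have "inner (quarter_turn n u) v = (\<Sum>i<2 * n. coord (quarter_turn n u) i * coord v i)"
    using assms by (intro inner_euc quarter_turn_euc) auto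
  also have "\<dots> = omega_st n u v"
    unfolding sum_lessThan_double omega_st_def
    by (intro sum.cong refl) (use coord_quarter_turn[of _ n u] in auto)
  finally show ?thesis by simp
qed

lemma omega_st_skew: "omega_st n u v = - omega_st n v u"
  unfolding omega_st_def sum_negf[symmetric] by (intro sum.cong refl) (simp add: algebra_simps)

lemma quarter_turn_quarter_turn:
  assumes "u \<in> euc (2 * n)"
  shows "quarter_turn n (quarter_turn n u) = - u"
proof (rule fin_seq_eqI)
  fix i
  show "coord (quarter_turn n (quarter_turn n u)) i = coord (- u) i"
  proof (cases "i < 2 * n")
    case True
    then have "i div 2 < n" "i = 2 * (i div 2) \<or> i = 2 * (i div 2) + 1" by presburger+
    then obtain j where "j < n" "i = 2 * j \<or> i = 2 * j + 1" by blast
    then show ?thesis using coord_quarter_turn[of j n] by auto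
  next
    case False
    then have "2 * n \<le> i" by simp
    then show ?thesis using assms by (simp add: coord_quarter_turn_ge euc_def)
  qed
qed

text \<open>If the inequality failed everywhere, then \<open>T \<circ> J\<close>, with the quarter turn \<open>J\<close>, would map the
  ellipsoid \<open>norm (T' x) \<le> 1\<close>, whose volume is \<open>d\<close> times that of the unit ball \<open>K\<close>, into the ball of
  radius \<open>B\<close>. Comparing volumes, \<open>d * (d * vol K) \<le> B ^ (2 * n) * vol K\<close>, contrary to \<open>B ^ n < d\<close>.\<close>

lemma ex_omega_st_large:
  assumes T: "lin_change (2 * n) T T' d" and B: "B > 0" "B ^ n < d"
  obtains u v where "u \<in> euc (2 * n)" "v \<in> euc (2 * n)" "omega_st n u v > B * norm (T' u) * norm (T' v)"
proof (rule ccontr)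
  assume "\<not> thesis"
  with that have le: "omega_st n u v \<le> B * norm (T' u) * norm (T' v)"
    if "u \<in> euc (2 * n)" "v \<in> euc (2 * n)" for u v
    using that by (meson not_less)
  note TD = lin_changeD[OF T]
  let ?J = "quarter_turn n"
  have bound: "norm (T (?J u)) \<le> B * norm (T' u)" if u: "u \<in> euc (2 * n)" for u
  proof -
    have Ju: "?J u \<in> euc (2 * n)" using u by (intro quarter_turn_euc) auto
    then have "T (?J u) \<in> T' ` euc (2 * n)" using TD(3,4) by simp
    then obtain v where v: "v \<in> euc (2 * n)" "T (?J u) = T' v" by auto
    have "(norm (T (?J u)))\<^sup>2 = inner (T (?J u)) (T' v)"
      by (simp add: v(2) power2_norm_eq_inner)
    also have "\<dots> = omega_st n u v"
      by (simp add: TD(5)[OF Ju v(1)] omega_st_eq_inner[OF u])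
    also have "\<dots> \<le> B * norm (T' u) * norm (T (?J u))"
      using le[OF u v(1)] v(2) by simp
    finally have "norm (T (?J u)) * norm (T (?J u)) \<le> B * norm (T' u) * norm (T (?J u))"
      by (simp add: power2_eq_square)
    then show ?thesis
      using B by (cases "norm (T (?J u)) = 0") (auto simp: mult_le_cancel_right)
  qed
  define \<beta> where "\<beta> = unit_ball_vol (real (2 * n))"
  have \<beta>: "\<beta> > 0" by (simp add: \<beta>_def)
  define E where "E = T' -` cball 0 1"
  have [measurable]: "E \<in> sets borel"
    unfolding E_def using measurable_sets[OF scales_volumeD(2)[OF TD(7)], of "cball 0 1"] by simp
  have TJ: "scales_volume (2 * n) (\<lambda>x. T (?J x)) (d * 1)"
    by (intro scales_volume_comp[OF TD(6)] scales_volume_quarter_turn) simp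
  define F where "F = (\<lambda>x. T (?J x)) -` cball 0 B"
  have [measurable]: "F \<in> sets borel"
    unfolding F_def using measurable_sets[OF scales_volumeD(2)[OF TJ], of "cball 0 B"] by simp
  have "emeasure (leb (2 * n)) E * ennreal (1 / d) = ennreal \<beta>"
    using scales_volume_emeasure[OF TD(7), of "cball 0 1"] by (simp add: E_def emeasure_leb_cball \<beta>_def)
  then have "emeasure (leb (2 * n)) E * ennreal (1 / d) * ennreal d = ennreal \<beta> * ennreal d" by simp
  then have E: "emeasure (leb (2 * n)) E = ennreal (\<beta> * d)"
    using TD(8) \<beta> by (simp add: mult.assoc ennreal_mult[symmetric])
  have "emeasure (leb (2 * n)) F * ennreal d = ennreal (\<beta> * B ^ (2 * n))"
    using scales_volume_emeasure[OF TJ, of "cball 0 B"] B by (simp add: F_def emeasure_leb_cball \<beta>_def)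
  moreover have "emeasure (leb (2 * n)) E \<le> emeasure (leb (2 * n)) F"
  proof -
    have "(\<integral>\<^sup>+x. indicator E x \<partial>leb (2 * n)) \<le> (\<integral>\<^sup>+x. indicator F x \<partial>leb (2 * n))"
    proof (rule nn_integral_leb_mono)
      fix x assume x: "x \<in> euc (2 * n)"
      have "x \<in> F" if "x \<in> E"
      proof -
        have "B * norm (T' x) \<le> B * 1" using that B unfolding E_def by (intro mult_left_mono) auto
        with bound[OF x] show ?thesis by (simp add: F_def)
      qed
      then show "(indicator E x :: ennreal) \<le> indicator F x" by (auto simp: indicator_def)
    qed measurable
    then show ?thesis by simp
  qed
  ultimately have "ennreal (\<beta> * d) * ennreal d \<le> ennreal (\<beta> * B ^ (2 * n))"
    unfolding E by (metis mult_right_mono zero_le)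
  then have "\<beta> * d * d \<le> \<beta> * B ^ (2 * n)"
    using \<beta> B TD(8) by (simp add: ennreal_mult[symmetric])
  then have "d * d \<le> B ^ (2 * n)" using \<beta> by simp
  then have "d\<^sup>2 \<le> (B ^ n)\<^sup>2" by (simp only: power_even_eq power2_eq_square)
  then have "d \<le> B ^ n" by (rule power2_le_imp_le) (use B in simp)
  with B show False by simp
qed

section \<open>Linear symplectic maps with two prescribed coordinates\<close>

lemma omega_st_bilinear:
  "omega_st n (x + y) z = omega_st n x z + omega_st n y z"
  "omega_st n z (x + y) = omega_st n z x + omega_st n z y"
  "omega_st n (x - y) z = omega_st n x z - omega_st n y z"
  "omega_st n z (x - y) = omega_st n z x - omega_st n z y"
  "omega_st n (c *\<^sub>R x) z = c * omega_st n x z"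
  "omega_st n z (c *\<^sub>R x) = c * omega_st n z x"
  "omega_st n (- x) z = - omega_st n x z"
  unfolding omega_st_def sum.distrib[symmetric] sum_subtractf[symmetric] sum_distrib_left sum_negf[symmetric]
  by (auto intro!: sum.cong simp: algebra_simps)

lemma omega_st_self [simp]: "omega_st n x x = 0"
  by (simp add: omega_st_def mult.commute)

lemma omega_st_unit_seq:
  assumes "x \<in> euc (2 * n)" "n \<ge> 1"
  shows "omega_st n x (unit_seq 1) = coord x 0" "omega_st n (unit_seq 0) x = coord x 1"
proof -
  have "omega_st n x (unit_seq 1) = coord (quarter_turn n x) 1"
    "omega_st n x (unit_seq 0) = coord (quarter_turn n x) 0"
    using assms by (simp_all add: omega_st_eq_inner)
  then show "omega_st n x (unit_seq 1) = coord x 0" "omega_st n (unit_seq 0) x = coord x 1"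
    using coord_quarter_turn[of 0 n x] assms(2) omega_st_skew[of n "unit_seq 0" x] by auto
qed

lemma Sp_comp: "\<phi> \<in> Sp n \<Longrightarrow> \<psi> \<in> Sp n \<Longrightarrow> (\<lambda>x. \<phi> (\<psi> x)) \<in> Sp n"
  unfolding Sp_def using linear_compose[of \<psi> \<phi>] by (auto simp: comp_def image_subset_iff)

text \<open>The symplectic transvection along \<open>y - x\<close>; it fixes the \<open>\<omega>\<close>-orthogonal complement of
  \<open>y - x\<close>.\<close>

lemma ex_transvection:
  assumes x: "x \<in> euc (2 * n)" and y: "y \<in> euc (2 * n)" and xy: "omega_st n x y \<noteq> 0"
  obtains \<tau> where "\<tau> \<in> Sp n" "\<tau> x = y" "\<And>z. omega_st n z (y - x) = 0 \<Longrightarrow> \<tau> z = z"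
proof
  define w where "w = y - x"
  define l where "l = 1 / omega_st n x y"
  define \<tau> where "\<tau> z = z + (l * omega_st n z w) *\<^sub>R w" for z
  have "linear \<tau>"
    by (rule linearI) (auto simp: \<tau>_def omega_st_bilinear algebra_simps)
  moreover have "\<tau> ` euc (2 * n) \<subseteq> euc (2 * n)"
    using x y by (auto simp: \<tau>_def w_def intro!: euc_arith)
  moreover have "omega_st n (\<tau> u) (\<tau> v) = omega_st n u v" for u v
    using omega_st_skew[of n w v] unfolding \<tau>_def by (simp add: omega_st_bilinear)
  ultimately show "\<tau> \<in> Sp n" by (auto simp: Sp_def)
  have "omega_st n x w = omega_st n x y" by (simp add: w_def omega_st_bilinear)
  then show "\<tau> x = y" using xy by (simp add: \<tau>_def l_def w_def)
  show "\<tau> z = z" if "omega_st n z (y - x) = 0" for z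
    using that by (simp add: \<tau>_def w_def)
qed

text \<open>The symplectic group acts transitively on pairs \<open>q\<close>, \<open>p\<close> with \<open>\<omega>(q, p) = 1\<close>. Two
  transvections move \<open>q\<close> to the first basis vector, and at most two more, fixing that vector, move the
  image of \<open>p\<close> to the second one. Each time an intermediate point is chosen that is not
  \<open>\<omega>\<close>-orthogonal to its neighbours.\<close>

lemma ex_Sp_basis:
  assumes q: "q \<in> euc (2 * n)" and p: "p \<in> euc (2 * n)" and qp: "omega_st n q p = 1" and n: "n \<ge> 1"
  obtains \<psi> where "\<psi> \<in> Sp n" "\<psi> q = unit_seq 0" "\<psi> p = unit_seq 1"
proof -
  let ?e = "unit_seq 0" and ?f = "unit_seq 1"
  have e: "?e \<in> euc (2 * n)" and f: "?f \<in> euc (2 * n)" using n by auto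
  have ef: "omega_st n ?e ?f = 1" using omega_st_unit_seq(1)[OF e n] by simp
  have fe: "omega_st n ?f ?e = -1" using ef omega_st_skew[of n ?f ?e] by simp
  obtain z where z: "z \<in> euc (2 * n)" "omega_st n q z \<noteq> 0" "omega_st n z ?e \<noteq> 0"
  proof (cases "omega_st n p ?e \<noteq> 0")
    case True
    then show ?thesis using that[of p] p qp by simp
  next
    case pe: False
    show ?thesis
    proof (cases "omega_st n q ?f \<noteq> 0")
      case True
      then show ?thesis using that[of ?f] f fe by simp
    next
      case False
      then have 0: "omega_st n q ?f = 0" "omega_st n p ?e = 0" using pe by blast+
      have "omega_st n q (p + ?f) = 1 + 0" "omega_st n (p + ?f) ?e = 0 + (-1)"
        by (simp_all only: omega_st_bilinear 0 qp fe)
      then have "omega_st n q (p + ?f) \<noteq> 0" "omega_st n (p + ?f) ?e \<noteq> 0" by linarith+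
      with subspace_add[OF subspace_euc p f] show ?thesis by (rule that)
    qed
  qed
  obtain \<tau>1 where t1: "\<tau>1 \<in> Sp n" "\<tau>1 q = z" by (rule ex_transvection[OF q z(1,2)], rule that)
  obtain \<tau>2 where t2: "\<tau>2 \<in> Sp n" "\<tau>2 z = ?e" by (rule ex_transvection[OF z(1) e z(3)], rule that)
  define p' where "p' = \<tau>2 (\<tau>1 p)"
  have t21: "(\<lambda>x. \<tau>2 (\<tau>1 x)) \<in> Sp n" by (rule Sp_comp[OF t2(1) t1(1)])
  have p': "p' \<in> euc (2 * n)" using t21 p by (auto simp: Sp_def p'_def)
  have "omega_st n (\<tau>2 (\<tau>1 q)) (\<tau>2 (\<tau>1 p)) = 1"
    using t21 p q qp by (simp add: Sp_def)
  then have ep: "omega_st n ?e p' = 1" by (simp add: t1 t2 p'_def)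
  have "\<exists>\<tau>3\<in>Sp n. \<tau>3 ?e = ?e \<and> \<tau>3 p' = ?f"
  proof (cases "omega_st n p' ?f = 0")
    case False
    obtain \<tau> where "\<tau> \<in> Sp n" "\<tau> p' = ?f" "\<And>z. omega_st n z (?f - p') = 0 \<Longrightarrow> \<tau> z = z"
      by (rule ex_transvection[OF p' f False], rule that)
    moreover have "omega_st n ?e (?f - p') = 0" using ef ep by (simp add: omega_st_bilinear)
    ultimately show ?thesis by blast
  next
    case True
    let ?z = "p' + ?e"
    have z': "?z \<in> euc (2 * n)" using p' e by (intro euc_arith)
    have a: "omega_st n p' ?z \<noteq> 0" using ep omega_st_skew[of n p' ?e] by (simp add: omega_st_bilinear)
    have b: "omega_st n ?z ?f \<noteq> 0" using ef True by (simp add: omega_st_bilinear)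
    obtain \<tau> where t: "\<tau> \<in> Sp n" "\<tau> p' = ?z" "\<And>z. omega_st n z (?z - p') = 0 \<Longrightarrow> \<tau> z = z"
      by (rule ex_transvection[OF p' z' a], rule that)
    obtain \<sigma> where s: "\<sigma> \<in> Sp n" "\<sigma> ?z = ?f" "\<And>z. omega_st n z (?f - ?z) = 0 \<Longrightarrow> \<sigma> z = z"
      by (rule ex_transvection[OF z' f b], rule that)
    have "\<tau> ?e = ?e" by (rule t(3)) simp
    moreover have "\<sigma> ?e = ?e" by (rule s(3)) (use ef ep in \<open>simp add: omega_st_bilinear\<close>)
    ultimately show ?thesis
      using Sp_comp[OF s(1) t(1)] s(2) t(2) by (intro bexI[of _ "\<lambda>x. \<sigma> (\<tau> x)"]) auto
  qed
  then obtain \<tau>3 where t3: "\<tau>3 \<in> Sp n" "\<tau>3 ?e = ?e" "\<tau>3 p' = ?f" by blast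
  show ?thesis
    by (rule that[OF Sp_comp[OF t3(1) t21]]) (simp_all add: t1 t2 t3 flip: p'_def)
qed

text \<open>The functionals become the first two coordinates of a symplectic map that sends their
  \<open>\<omega>\<close>-dual vectors to the standard ones. The image then lies in the closed disc of radius
  \<open>sqrt 2 * \<rho>\<close> times the other coordinates; the factor 3 instead of 2 accounts for the open cylinder.\<close>

lemma c_lin_Z_le:
  assumes U: "U \<subseteq> euc (2 * n)" and n: "n \<ge> 1" and u: "u \<in> euc (2 * n)" and v: "v \<in> euc (2 * n)"
    and uv: "omega_st n u v = 1" and \<rho>: "\<rho> > 0"
    and bound: "\<And>z. z \<in> U \<Longrightarrow> \<bar>inner u z\<bar> \<le> \<rho> \<and> \<bar>inner v z\<bar> \<le> \<rho>"
  shows "c_lin_Z n U \<le> ereal (pi * (3 * \<rho>\<^sup>2))"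
proof -
  let ?J = "quarter_turn n"
  define q where "q = - ?J v"
  define p where "p = ?J u"
  have Jeuc: "?J x \<in> euc (2 * n)" if "x \<in> euc (2 * n)" for x
    using that by (intro quarter_turn_euc) auto
  have qp_euc: "q \<in> euc (2 * n)" "p \<in> euc (2 * n)"
    unfolding q_def p_def using u v by (auto intro!: Jeuc euc_arith)
  have zp: "omega_st n z p = inner u z" if "z \<in> euc (2 * n)" for z
    using that by (simp add: omega_st_eq_inner p_def inner_quarter_turn inner_commute)
  have qz: "omega_st n q z = inner v z" for z
    using omega_st_eq_inner[OF Jeuc[OF v], of z] quarter_turn_quarter_turn[OF v]
    by (simp add: q_def omega_st_bilinear)
  have "omega_st n q p = 1"
    using uv omega_st_eq_inner[OF u, of v] by (simp add: qz p_def inner_commute)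
  then obtain \<psi> where \<psi>: "\<psi> \<in> Sp n" "\<psi> q = unit_seq 0" "\<psi> p = unit_seq 1"
    using ex_Sp_basis[OF qp_euc _ n] by blast
  have \<psi>_euc: "\<psi> z \<in> euc (2 * n)" if "z \<in> euc (2 * n)" for z
    using \<psi>(1) that by (auto simp: Sp_def)
  have coords: "coord (\<psi> z) 0 = inner u z" "coord (\<psi> z) 1 = inner v z" if z: "z \<in> euc (2 * n)" for z
  proof -
    have "omega_st n (\<psi> z) (\<psi> p) = omega_st n z p" "omega_st n (\<psi> q) (\<psi> z) = omega_st n q z"
      using \<psi>(1) z qp_euc by (auto simp: Sp_def)
    then show "coord (\<psi> z) 0 = inner u z" "coord (\<psi> z) 1 = inner v z"
      using omega_st_unit_seq[OF \<psi>_euc[OF z] n] zp[OF z] qz by (simp_all add: \<psi>)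
  qed
  define r where "r = sqrt 3 * \<rho>"
  have r: "r > 0" "r\<^sup>2 = 3 * \<rho>\<^sup>2" using \<rho> by (simp_all add: r_def power_mult_distrib)
  have "\<psi> ` U \<subseteq> sympl_cylinder n r"
  proof
    fix x assume "x \<in> \<psi> ` U"
    then obtain z where z: "z \<in> U" "x = \<psi> z" by auto
    with U have ze: "z \<in> euc (2 * n)" by auto
    define w where "w = emb 2 (coord x)"
    have cw: "coord x 0 = coord w 0" "coord x 1 = coord w 1" by (simp_all add: w_def)
    have sq: "(coord x 0)\<^sup>2 \<le> \<rho>\<^sup>2" "(coord x 1)\<^sup>2 \<le> \<rho>\<^sup>2"
      unfolding z(2) coords[OF ze] using bound[OF z(1)] \<rho> by (simp_all add: abs_le_square_iff[symmetric])
    have "(norm w)\<^sup>2 = (\<Sum>i<2. (coord w i)\<^sup>2)" by (rule norm_euc) (simp add: w_def)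
    also have "\<dots> = (coord x 0)\<^sup>2 + (coord x 1)\<^sup>2" by (simp add: w_def numeral_2_eq_2)
    also have "\<dots> \<le> \<rho>\<^sup>2 + \<rho>\<^sup>2" using sq by (rule add_mono)
    also have "\<dots> < r\<^sup>2" using \<rho> unfolding r by simp
    finally have "norm w < r" by (rule power_less_imp_less_base) (use r(1) in simp)
    then have "w \<in> euc_ball 2 r" by (simp add: euc_ball_def w_def)
    with cw show "x \<in> sympl_cylinder n r"
      unfolding sympl_cylinder_def z(2) using \<psi>_euc[OF ze] by blast
  qed
  then have "ereal (pi * r\<^sup>2) \<in> {ereal (pi * r\<^sup>2) |r. r > 0 \<and> (\<exists>\<psi>\<in>Sp n. \<psi> ` U \<subseteq> sympl_cylinder n r)}"
    using r \<psi>(1) by blast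
  then have "c_lin_Z n U \<le> ereal (pi * r\<^sup>2)" unfolding c_lin_Z_def by (rule Inf_lower)
  then show ?thesis by (simp add: r)
qed

section \<open>The estimate for sums of symmetric segments\<close>

text \<open>In a balanced position the ellipsoid \<open>norm (T' x) \<le> 1\<close> bounds the support function from above
  by \<open>S * sqrt (3 / m)\<close>, and \<open>S\<close> is bounded by the volume. With \<open>g = d powr (1 / n)\<close>, a pair that
  is nearly optimal for the ellipsoid has \<open>\<omega>(u, w) > g / 2\<close> on the unit sphere of \<open>norm (T' x)\<close>;
  normalising to \<open>\<omega>(u, w) = 1\<close> leaves both vectors with the same length \<open>\<kappa>\<close>, where \<open>\<kappa>\<^sup>2 \<le> 2 / g\<close>.
  The unknown \<open>g\<close> cancels in the product of the bounds for \<open>S\<^sup>2\<close> and \<open>\<kappa>\<^sup>2\<close>.\<close>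

lemma ex_sympl_pair_segment_sum:
  assumes v: "\<And>i. i < N \<Longrightarrow> v i \<in> euc (2 * n)" and n: "n \<ge> 1"
    and pos: "measure (leb (2 * n)) (segment_sum N v) > 0"
  defines "\<rho> \<equiv> sqrt (192 * real n * measure (leb (2 * n)) (segment_sum N v) powr (1 / n))"
  obtains u w where "u \<in> euc (2 * n)" "w \<in> euc (2 * n)" "omega_st n u w = 1"
    "(\<Sum>i<N. \<bar>inner u (v i)\<bar>) \<le> \<rho>" "(\<Sum>i<N. \<bar>inner w (v i)\<bar>) \<le> \<rho>"
proof -
  define m where "m = 2 * n"
  define V where "V = measure (leb m) (segment_sum N v)"
  have V: "V > 0" using pos by (simp add: V_def m_def)
  have vm: "\<And>i. i < N \<Longrightarrow> v i \<in> euc m" using v by (simp add: m_def)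
  have m: "m > 0" using n by (simp add: m_def)
  obtain T T' d S where T: "lin_change m T T' d" and S_eq: "S = (\<Sum>i<N. norm (T (v i)))" and S: "S > 0"
    and lower: "\<And>x. x \<in> euc m \<Longrightarrow> S / (4 * m) * (norm x)\<^sup>2 \<le> (\<Sum>i<N. (inner x (T (v i)))\<^sup>2 / norm (T (v i)))"
    and upper: "\<And>x. x \<in> euc m \<Longrightarrow> (\<Sum>i<N. (inner x (T (v i)))\<^sup>2 / norm (T (v i))) \<le> 3 * S / m * (norm x)\<^sup>2"
    using balanced_position[OF vm pos[folded m_def] m] by blast
  note TD = lin_changeD[OF T]
  have T'euc: "T' x \<in> euc m" if "x \<in> euc m" for x using TD(4) that by blast
  have h: "(\<Sum>i<N. \<bar>inner x (v i)\<bar>) \<le> S * sqrt (3 / m) * norm (T' x)" if x: "x \<in> euc m" for x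
  proof -
    have "(\<Sum>i<N. \<bar>inner x (v i)\<bar>) = (\<Sum>i<N. \<bar>inner (T' x) (T (v i))\<bar>)"
      using TD(5)[OF vm x] by (intro sum.cong refl) (simp add: inner_commute)
    also have "\<dots> \<le> S * sqrt (3 / m) * norm (T' x)"
      by (rule sum_abs_inner_le[OF upper[OF T'euc[OF x]] S_eq])
    finally show ?thesis .
  qed
  define g where "g = d powr (1 / n)"
  have d: "d > 0" using TD(8) .
  have g: "g > 0" "g ^ n = d"
    using d n by (simp_all add: g_def powr_realpow[symmetric] powr_powr)
  have SV: "S\<^sup>2 \<le> 64 * n\<^sup>2 * (g * V powr (1 / n))"
  proof -
    have "(S / (4 * m)) ^ m \<le> measure (leb m) (segment_sum N (\<lambda>i. T (v i)))"
      using S lower vm TD(3) by (intro volume_segment_sum_ge[where q="\<lambda>i. norm (T (v i))"]) auto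
    also have "\<dots> = d * V"
      using measure_lin_change[OF T, of "segment_sum N v"] vm
      by (simp add: linear_segment_sum[OF TD(1)] compact_segment_sum segment_sum_euc V_def)
    finally have "((S / (8 * n))\<^sup>2) ^ n \<le> (g * V powr (1 / n)) ^ n"
      using V n by (simp add: m_def power_mult[symmetric] power_mult_distrib g powr_realpow[symmetric] powr_powr)
    then have "(S / (8 * n))\<^sup>2 \<le> g * V powr (1 / n)"
      using g V n by (subst (asm) power_mono_iff) auto
    then show ?thesis using n by (simp add: power_divide power_mult_distrib field_simps)
  qed
  obtain u0 w0 where uw0: "u0 \<in> euc m" "w0 \<in> euc m" and
    om: "omega_st n u0 w0 > g / 2 * norm (T' u0) * norm (T' w0)"
  proof -
    have "(g / 2) ^ n < d"
      using g n by (simp add: power_divide divide_less_eq d)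
    then show thesis
      using ex_omega_st_large[OF T[unfolded m_def], of "g / 2"] g that by (auto simp: m_def)
  qed
  define a where "a = norm (T' u0)"
  define c where "c = norm (T' w0)"
  define \<omega> where "\<omega> = omega_st n u0 w0"
  have "0 \<le> g / 2 * a * c" using g by (simp add: a_def c_def)
  with om have \<omega>: "\<omega> > 0" "g / 2 * a * c < \<omega>" by (simp_all add: \<omega>_def a_def c_def)
  have nz: "norm (T' x) > 0" if x: "x \<in> euc m" "x \<noteq> 0" for x
  proof -
    have "T' x \<noteq> 0" using TD(5)[OF x(1) x(1)] x(2) by auto
    then show ?thesis by simp
  qed
  have "u0 \<noteq> 0" "w0 \<noteq> 0" using \<omega>(1) by (auto simp: \<omega>_def omega_st_def)
  then have ac: "a > 0" "c > 0" using nz uw0 by (auto simp: a_def c_def)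
  define \<kappa> where "\<kappa> = sqrt (a * c / \<omega>)"
  have \<kappa>: "\<kappa> > 0" "\<kappa>\<^sup>2 = a * c / \<omega>" using ac \<omega> by (simp_all add: \<kappa>_def)
  have \<kappa>g: "\<kappa>\<^sup>2 \<le> 2 / g" using \<omega> g unfolding \<kappa>(2) by (simp add: field_simps)
  define u where "u = (\<kappa> / a) *\<^sub>R u0"
  define w where "w = (\<kappa> / c) *\<^sub>R w0"
  have uw: "u \<in> euc m" "w \<in> euc m" using uw0 by (auto simp: u_def w_def intro!: euc_arith)
  have "omega_st n u w = \<kappa>\<^sup>2 * \<omega> / (a * c)"
    by (simp add: u_def w_def omega_st_bilinear \<omega>_def power2_eq_square mult.commute[of a c])
  also have "\<dots> = 1" using ac \<omega> unfolding \<kappa>(2) by simp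
  finally have om1: "omega_st n u w = 1" .
  have nrm: "norm (T' u) = \<kappa>" "norm (T' w) = \<kappa>"
    using ac \<kappa> by (simp_all add: u_def w_def linear_scale[OF TD(2)] flip: a_def c_def)
  have "S * sqrt (3 / m) * \<kappa> \<le> \<rho>"
  proof -
    have "(S * sqrt (3 / m) * \<kappa>)\<^sup>2 = S\<^sup>2 * (3 / m) * \<kappa>\<^sup>2" by (simp add: power_mult_distrib)
    also have "\<dots> \<le> (64 * n\<^sup>2 * (g * V powr (1 / n))) * (3 / m) * (2 / g)"
      using SV \<kappa>g g V by (intro mult_mono) auto
    also have "\<dots> = 192 * real n * V powr (1 / n)"
      using g n by (simp add: m_def power2_eq_square)
    finally have "(S * sqrt (3 / m) * \<kappa>)\<^sup>2 \<le> 192 * real n * V powr (1 / n)" .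
    then show ?thesis by (simp add: \<rho>_def V_def m_def real_le_rsqrt)
  qed
  then show ?thesis
    using that[of u w] h[OF uw(1)] h[OF uw(2)] uw om1 nrm by (simp add: m_def)
qed

section \<open>Zonoids\<close>

text \<open>Averaging a ball in \<open>Z\<close> with its reflection in the origin gives a ball about the origin.\<close>

lemma symmetric_ball_in:
  assumes Z: "zonoid m Z" and int: "top_of_set (euc m) interior_of Z \<noteq> {}"
  obtains \<epsilon> where "\<epsilon> > 0" "\<And>y. y \<in> euc m \<Longrightarrow> norm y \<le> \<epsilon> \<Longrightarrow> y \<in> Z"
proof -
  have conv: "convex Z" and symm: "uminus ` Z = Z" using Z by (auto simp: zonoid_def)
  obtain x S where S: "openin (top_of_set (euc m)) S" "x \<in> S" "S \<subseteq> Z"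
    using int unfolding interior_of_def by blast
  then obtain e where e: "e > 0" "ball x e \<inter> euc m \<subseteq> S" and xe: "x \<in> euc m"
    unfolding openin_contains_ball by blast
  have "y \<in> Z" if y: "y \<in> euc m" "norm y \<le> e / 2" for y
  proof -
    have "x + y \<in> ball x e \<inter> euc m" "x - y \<in> ball x e \<inter> euc m"
    proof -
      have "dist x (x + y) = norm y" "dist x (x - y) = norm y" by (simp_all add: dist_norm)
      then show "x + y \<in> ball x e \<inter> euc m" "x - y \<in> ball x e \<inter> euc m"
        using y e(1) subspace_add[OF subspace_euc xe y(1)] subspace_diff[OF subspace_euc xe y(1)] by auto
    qed
    then have "x + y \<in> Z" "x - y \<in> Z" using e(2) S(3) by blast+
    then have "x + y \<in> Z" "- (x - y) \<in> Z" using symm by blast+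
    then have "(1 / 2) *\<^sub>R (x + y) + (1 / 2) *\<^sub>R (- (x - y)) \<in> Z"
      by (intro convexD[OF conv]) auto
    also have "(1 / 2) *\<^sub>R (x + y) + (1 / 2) *\<^sub>R (- (x - y)) = y"
      by (simp add: algebra_simps flip: scaleR_left_distrib)
    finally show ?thesis .
  qed
  with e(1) show ?thesis by (intro that[of "e / 2"]) auto
qed

lemma closed_segment_eq_midpoint:
  fixes a b :: "'a::real_vector"
  shows "closed_segment a b = {(1 / 2) *\<^sub>R (a + b) + t *\<^sub>R ((1 / 2) *\<^sub>R (b - a)) | t. \<bar>t\<bar> \<le> 1}"
proof (intro equalityI subsetI)
  fix x assume "x \<in> closed_segment a b"
  then obtain u where u: "0 \<le> u" "u \<le> 1" "x = (1 - u) *\<^sub>R a + u *\<^sub>R b" by (auto simp: in_segment)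
  have "x = (1 / 2) *\<^sub>R (a + b) + (2 * u - 1) *\<^sub>R ((1 / 2) *\<^sub>R (b - a))"
    unfolding u by (simp add: algebra_simps scaleR_2[symmetric] flip: scaleR_left_distrib)
  moreover have "\<bar>2 * u - 1\<bar> \<le> 1" using u by auto
  ultimately show "x \<in> {(1 / 2) *\<^sub>R (a + b) + t *\<^sub>R ((1 / 2) *\<^sub>R (b - a)) | t. \<bar>t\<bar> \<le> 1}" by blast
next
  fix x assume "x \<in> {(1 / 2) *\<^sub>R (a + b) + t *\<^sub>R ((1 / 2) *\<^sub>R (b - a)) | t. \<bar>t\<bar> \<le> 1}"
  then obtain t where t: "\<bar>t\<bar> \<le> 1" "x = (1 / 2) *\<^sub>R (a + b) + t *\<^sub>R ((1 / 2) *\<^sub>R (b - a))" by blast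
  have "x = (1 - (1 + t) / 2) *\<^sub>R a + ((1 + t) / 2) *\<^sub>R b"
    unfolding t by (simp add: algebra_simps add_divide_distrib diff_divide_distrib)
  then show "x \<in> closed_segment a b"
    unfolding in_segment using t(1) by (intro exI[of _ "(1 + t) / 2"]) (auto simp: abs_le_iff)
qed

lemma zonotope_eq_segment_sum:
  assumes "zonotope m P"
  obtains N v c where "\<And>i. i < N \<Longrightarrow> v i \<in> euc m" "c \<in> euc m" "P = (+) c ` segment_sum N v"
proof -
  obtain k a b where ab: "\<forall>i<k. a i \<in> euc m \<and> b i \<in> euc m"
    and P: "P = (\<Sum>i<(k::nat). closed_segment (a i) (b i))"
    using assms by (auto simp: zonotope_def)
  define v where "v i = (1 / 2) *\<^sub>R (b i - a i)" for i
  define mid where "mid i = (1 / 2) *\<^sub>R (a i + b i)" for i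
  define c where "c = (\<Sum>i<k. mid i)"
  have "P = {sum s {..<k} | s. \<forall>i\<in>{..<k}. s i \<in> closed_segment (a i) (b i)}"
    unfolding P by (rule set_sum_alt) simp
  also have "\<dots> = (+) c ` segment_sum k v"
  proof (intro equalityI subsetI)
    fix x assume "x \<in> {sum s {..<k} | s. \<forall>i\<in>{..<k}. s i \<in> closed_segment (a i) (b i)}"
    then obtain s where x: "x = sum s {..<k}" and s: "\<forall>i\<in>{..<k}. s i \<in> closed_segment (a i) (b i)" by blast
    then have "\<forall>i\<in>{..<k}. \<exists>t. \<bar>t\<bar> \<le> 1 \<and> s i = mid i + t *\<^sub>R v i"
      unfolding closed_segment_eq_midpoint mid_def v_def by blast
    then obtain t where t: "\<And>i. i < k \<Longrightarrow> \<bar>t i\<bar> \<le> 1" "\<And>i. i < k \<Longrightarrow> s i = mid i + t i *\<^sub>R v i"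
      by (metis lessThan_iff)
    have "x = c + (\<Sum>i<k. t i *\<^sub>R v i)"
      unfolding x c_def sum.distrib[symmetric] by (intro sum.cong refl) (simp add: t)
    then show "x \<in> (+) c ` segment_sum k v"
      using segment_sumI[of k t v] t(1) by blast
  next
    fix x assume "x \<in> (+) c ` segment_sum k v"
    then obtain t where t: "\<forall>i<k. \<bar>t i\<bar> \<le> 1" and x: "x = c + (\<Sum>i<k. t i *\<^sub>R v i)"
      by (auto simp: segment_sum_def)
    have "x = (\<Sum>i<k. mid i + t i *\<^sub>R v i)" by (simp add: x c_def sum.distrib)
    moreover have "\<forall>i\<in>{..<k}. mid i + t i *\<^sub>R v i \<in> closed_segment (a i) (b i)"
      using t unfolding closed_segment_eq_midpoint mid_def v_def by blast
    ultimately show "x \<in> {sum s {..<k} | s. \<forall>i\<in>{..<k}. s i \<in> closed_segment (a i) (b i)}" by blast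
  qed
  finally have "P = (+) c ` segment_sum k v" .
  moreover have "v i \<in> euc m" if "i < k" for i
    using ab that unfolding v_def by (intro euc_arith) auto
  moreover have "c \<in> euc m"
    using ab unfolding c_def mid_def by (intro euc_arith) auto
  ultimately show ?thesis by (intro that)
qed

text \<open>Compactness makes the suprema in the definition of the distance suprema of bounded sets, so that
  they are upper bounds.\<close>

lemma hausdorff_dist_lessD:
  fixes S T :: "'a::metric_space set"
  assumes "hausdorff_dist S T < e" "compact S" "compact T" "S \<noteq> {}" "T \<noteq> {}"
  shows "x \<in> S \<Longrightarrow> \<exists>y\<in>T. dist x y < e" "y \<in> T \<Longrightarrow> \<exists>x\<in>S. dist y x < e"
proof -
  have near: "\<exists>y\<in>B. dist x y < e" if "x \<in> A" "compact A" "compact B" "B \<noteq> {}" "(SUP x\<in>A. infdist x B) < e"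
    for A B :: "'a set" and x
  proof -
    have "compact ((\<lambda>x. infdist x B) ` A)"
      using that by (intro compact_continuous_image continuous_intros)
    then have "bdd_above ((\<lambda>x. infdist x B) ` A)"
      by (intro bounded_imp_bdd_above compact_imp_bounded)
    then have "infdist x B \<le> (SUP x\<in>A. infdist x B)" using that by (intro cSUP_upper)
    then have "(INF y\<in>B. dist x y) < e" using that by (simp add: infdist_notempty)
    then show ?thesis using cInf_lessD[of "dist x ` B" e] that by blast
  qed
  show "x \<in> S \<Longrightarrow> \<exists>y\<in>T. dist x y < e" "y \<in> T \<Longrightarrow> \<exists>x\<in>S. dist y x < e"
    using near[of x S T] near[of y T S] assms by (auto simp: hausdorff_dist_def)
qed

lemma abs_inner_segment_sum_le:
  assumes "x \<in> segment_sum N v"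
  shows "\<bar>inner u x\<bar> \<le> (\<Sum>i<N. \<bar>inner u (v i)\<bar>)"
proof -
  obtain t where t: "\<forall>i<N. \<bar>t i\<bar> \<le> 1" "x = (\<Sum>i<N. t i *\<^sub>R v i)"
    using assms by (auto simp: segment_sum_def)
  have "\<bar>inner u x\<bar> \<le> (\<Sum>i<N. \<bar>t i\<bar> * \<bar>inner u (v i)\<bar>)"
    unfolding t(2) inner_sum_right by (rule order_trans[OF sum_abs]) (simp add: abs_mult)
  also have "\<dots> \<le> (\<Sum>i<N. 1 * \<bar>inner u (v i)\<bar>)"
    using t(1) by (intro sum_mono mult_right_mono) auto
  finally show ?thesis by simp
qed

lemma uminus_segment_sum: "x \<in> segment_sum N v \<Longrightarrow> - x \<in> segment_sum N v"
proof -
  assume "x \<in> segment_sum N v"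
  then obtain t where t: "\<forall>i<N. \<bar>t i\<bar> \<le> 1" "x = (\<Sum>i<N. t i *\<^sub>R v i)"
    by (auto simp: segment_sum_def)
  have "- x = (\<Sum>i<N. (- t i) *\<^sub>R v i)" by (simp add: t(2) sum_negf)
  also have "\<dots> \<in> segment_sum N v" using t(1) by (intro segment_sumI) auto
  finally show ?thesis .
qed

text \<open>A zonotope \<open>P\<close> that is closer to \<open>Z\<close> than half the radius \<open>\<epsilon>\<close> of a ball about 0 in \<open>Z\<close> lies in
  \<open>Z + Z = 2 Z\<close>, and its support function is at least half that of \<open>Z\<close>. Its centre \<open>c\<close> need not be 0,
  but both statements survive symmetrising, that is combining the estimates for \<open>c + x\<close>
  and \<open>c - x\<close>, or for \<open>u\<close> and \<open>- u\<close>.\<close>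

lemma zonoid_approx:
  assumes Z: "zonoid m Z" and int: "top_of_set (euc m) interior_of Z \<noteq> {}"
  obtains N v \<epsilon> where "\<And>i. i < N \<Longrightarrow> v i \<in> euc m" "segment_sum N v \<subseteq> (\<lambda>x. 2 *\<^sub>R x) ` Z"
    "\<And>u z. u \<in> euc m \<Longrightarrow> z \<in> Z \<Longrightarrow> \<bar>inner u z\<bar> \<le> 2 * (\<Sum>i<N. \<bar>inner u (v i)\<bar>)"
    "\<epsilon> > 0" "\<And>u. u \<in> euc m \<Longrightarrow> \<epsilon> * norm u \<le> (\<Sum>i<N. \<bar>inner u (v i)\<bar>)"
proof -
  have ZD: "Z \<subseteq> euc m" "Z \<noteq> {}" "compact Z" "convex Z" "uminus ` Z = Z"
    and approx: "\<And>\<epsilon>. \<epsilon> > 0 \<Longrightarrow> \<exists>P. zonotope m P \<and> hausdorff_dist Z P < \<epsilon>"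
    using Z by (auto simp: zonoid_def)
  have neg: "- z \<in> Z" if "z \<in> Z" for z using ZD(5) that by blast
  obtain \<epsilon> where \<epsilon>: "\<epsilon> > 0" and ball: "\<And>y. y \<in> euc m \<Longrightarrow> norm y \<le> \<epsilon> \<Longrightarrow> y \<in> Z"
    using symmetric_ball_in[OF Z int] by blast
  obtain P where P: "zonotope m P" "hausdorff_dist Z P < \<epsilon> / 2" using approx[of "\<epsilon> / 2"] \<epsilon> by auto
  obtain N v c where v: "\<And>i. i < N \<Longrightarrow> v i \<in> euc m" and c: "c \<in> euc m" and Pc: "P = (+) c ` segment_sum N v"
    using zonotope_eq_segment_sum[OF P(1)] by blast
  have Pcomp: "compact P" unfolding Pc
    by (intro compact_continuous_image compact_segment_sum continuous_intros)
  have "P \<noteq> {}" using segment_sumI[of N "\<lambda>_. 0" v] by (auto simp: Pc)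
  note near = hausdorff_dist_lessD[OF P(2) ZD(3) Pcomp ZD(2) this]
  have seg_euc: "x \<in> euc m" if "x \<in> segment_sum N v" for x
    using segment_sum_euc[of N v m] v that by blast
  have half: "(1 / 2) *\<^sub>R (c + x) \<in> Z" if x: "x \<in> segment_sum N v" for x
  proof -
    obtain z where z: "z \<in> Z" "dist (c + x) z < \<epsilon> / 2" using near(2)[of "c + x"] x Pc by blast
    have "c + x - z \<in> Z"
      using z \<epsilon> c seg_euc[OF x] ZD(1) by (intro ball euc_arith) (auto simp: dist_norm)
    then have "(1 / 2) *\<^sub>R z + (1 / 2) *\<^sub>R (c + x - z) \<in> Z"
      using z by (intro convexD[OF ZD(4)]) auto
    then show ?thesis by (simp add: algebra_simps)
  qed
  have sub: "segment_sum N v \<subseteq> (\<lambda>x. 2 *\<^sub>R x) ` Z"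
  proof
    fix x assume x: "x \<in> segment_sum N v"
    have "(1 / 2) *\<^sub>R ((1 / 2) *\<^sub>R (c + x)) + (1 / 2) *\<^sub>R (- ((1 / 2) *\<^sub>R (c + - x))) \<in> Z"
      using half[OF x] neg[OF half[OF uminus_segment_sum[OF x]]] by (intro convexD[OF ZD(4)]) auto
    also have "(1 / 2) *\<^sub>R ((1 / 2) *\<^sub>R (c + x)) + (1 / 2) *\<^sub>R (- ((1 / 2) *\<^sub>R (c + - x))) = (1 / 2) *\<^sub>R x"
      by (simp add: algebra_simps flip: scaleR_left_distrib)
    finally show "x \<in> (\<lambda>x. 2 *\<^sub>R x) ` Z" by (intro image_eqI[of _ _ "(1 / 2) *\<^sub>R x"]) auto
  qed
  have supp: "(\<forall>z\<in>Z. \<bar>inner u z\<bar> \<le> 2 * (\<Sum>i<N. \<bar>inner u (v i)\<bar>)) \<and>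
      \<epsilon> / 2 * norm u \<le> (\<Sum>i<N. \<bar>inner u (v i)\<bar>)" if u: "u \<in> euc m" for u
  proof -
    define g where "g = (\<Sum>i<N. \<bar>inner u (v i)\<bar>)"
    obtain z where z: "z \<in> Z" "\<And>y. y \<in> Z \<Longrightarrow> inner u y \<le> inner u z"
    proof -
      have "continuous_on Z (inner u)" by (intro continuous_intros)
      with that show thesis using continuous_attains_sup[OF ZD(3,2), of "inner u"] by blast
    qed
    have \<epsilon>u: "\<epsilon> * norm u \<le> inner u z"
    proof (cases "u = 0")
      case False
      have "(\<epsilon> / norm u) *\<^sub>R u \<in> Z" using \<epsilon> u False by (intro ball euc_arith) auto
      from z(2)[OF this] show ?thesis using False by (simp add: power2_norm_eq_inner[symmetric] power2_eq_square)
    qed simp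
    have upper: "inner s y \<le> inner s c + g + \<epsilon> / 2 * norm u" if y: "y \<in> Z" and s: "s = u \<or> s = - u" for y s
    proof -
      obtain x where x: "x \<in> segment_sum N v" "dist y (c + x) < \<epsilon> / 2"
        using near(1)[OF y] by (auto simp: Pc)
      have "inner s y = inner s c + inner s x + inner s (y - (c + x))"
        by (simp add: inner_diff_right inner_add_right)
      also have "inner s x \<le> g" using abs_inner_segment_sum_le[OF x(1), of u] s by (auto simp: g_def)
      also have "inner s (y - (c + x)) \<le> norm s * norm (y - (c + x))" by (rule norm_cauchy_schwarz)
      also have "\<dots> \<le> norm s * (\<epsilon> / 2)" using x(2) by (intro mult_left_mono) (auto simp: dist_norm)
      also have "norm s = norm u" using s by auto
      finally show ?thesis by (simp add: mult.commute)
    qed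
    have "inner u z \<le> g + \<epsilon> / 2 * norm u"
      using upper[OF z(1), of u] upper[OF neg[OF z(1)], of "- u"] by simp
    with \<epsilon>u have "inner u z \<le> 2 * g" by simp
    moreover have "\<bar>inner u y\<bar> \<le> inner u z" if "y \<in> Z" for y
      using z(2)[OF that] z(2)[OF neg[OF that]] by (auto simp: abs_le_iff)
    ultimately show ?thesis using \<epsilon>u unfolding g_def[symmetric] by (force intro: order_trans)
  qed
  show ?thesis
    by (rule that[OF v sub _ half_gt_zero[OF \<epsilon>]]) (use supp in auto)
qed

section \<open>The volume of the Euclidean ball and the conclusion\<close>

lemma power_div_fact_le_exp:
  fixes x :: real
  assumes "x \<ge> 0"
  shows "x ^ n / fact n \<le> exp x"
proof -
  have sm: "(\<lambda>k. x ^ k /\<^sub>R fact k) sums exp x" by (rule exp_converges)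
  have "(\<Sum>k\<in>{n}. x ^ k /\<^sub>R fact k) \<le> (\<Sum>k. x ^ k /\<^sub>R fact k)"
    using assms by (intro sum_le_suminf sums_summable[OF sm]) auto
  then show ?thesis using sums_unique[OF sm] by (simp add: divide_inverse mult.commute)
qed

text \<open>The volume is at most \<open>pi ^ n / n!\<close>, and \<open>n ^ n / n! \<le> exp n\<close>. The constant 12 is a bound for
  \<open>pi * exp 1\<close>.\<close>

lemma vol_euc_ball:
  assumes "n \<ge> 1"
  shows "vol (2 * n) (euc_ball (2 * n) 1) > 0" "vol (2 * n) (euc_ball (2 * n) 1) \<le> (12 / n) ^ n"
proof -
  let ?m = "2 * n"
  have eq: "euc_ball ?m 1 = ball 0 1 \<inter> euc ?m" by (auto simp: euc_ball_def)
  have E: "euc ?m \<in> sets borel" by (intro borel_closed closed_euc)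
  have B: "euc_ball ?m 1 \<in> sets borel" unfolding eq by (intro sets.Int borel_open open_ball E)
  have v: "vol ?m (euc_ball ?m 1) = measure (leb ?m) (euc_ball ?m 1)"
    by (rule vol_eq_leb[OF B]) (auto simp: eq)
  have fin: "emeasure (leb ?m) (euc_ball ?m 1) \<le> emeasure (leb ?m) (cball 0 1)"
    unfolding eq by (intro emeasure_mono) auto
  then have em: "emeasure (leb ?m) (euc_ball ?m 1) = ennreal (measure (leb ?m) (euc_ball ?m 1))"
    by (intro emeasure_eq_ennreal_measure) (auto simp: emeasure_leb_cball top_unique)
  have "emeasure (leb ?m) (cball 0 (1 / 2)) = emeasure (leb ?m) (cball 0 (1 / 2) \<inter> euc ?m)"
    by (rule emeasure_leb_cong) (use E in auto)
  also have "\<dots> \<le> emeasure (leb ?m) (euc_ball ?m 1)"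
    using B by (intro emeasure_mono) (auto simp: eq)
  finally have "unit_ball_vol ?m * (1 / 2) ^ ?m \<le> measure (leb ?m) (euc_ball ?m 1)"
    unfolding em by (simp add: emeasure_leb_cball)
  moreover have "unit_ball_vol ?m * (1 / 2) ^ ?m > 0" by simp
  ultimately show "vol ?m (euc_ball ?m 1) > 0" unfolding v by linarith
  have "measure (leb ?m) (euc_ball ?m 1) \<le> unit_ball_vol ?m"
    using fin unfolding em by (simp add: emeasure_leb_cball)
  also have "\<dots> = pi ^ n / fact n" using unit_ball_vol_even[of n] by simp
  also have "\<dots> \<le> (12 / n) ^ n"
  proof -
    have "real n ^ n / fact n \<le> exp 1 ^ n"
      using power_div_fact_le_exp[of "real n" n] by (simp add: exp_of_nat_mult[symmetric])
    also have "\<dots> \<le> 3 ^ n" by (intro power_mono exp_le) auto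
    finally have "real n ^ n / fact n * pi ^ n \<le> 3 ^ n * 4 ^ n"
      using pi_less_4 by (intro mult_mono power_mono) auto
    also have "\<dots> = 12 ^ n" by (simp flip: power_mult_distrib)
    finally show ?thesis using assms by (simp add: power_divide field_simps)
  qed
  finally show "vol ?m (euc_ball ?m 1) \<le> (12 / n) ^ n" unfolding v .
qed

text \<open>By the Cauchy-Schwarz inequality a lower bound for the support function bounds the quadratic form
  of the volume estimate from below.\<close>

lemma measure_segment_sum_pos:
  assumes v: "\<And>i. i < N \<Longrightarrow> v i \<in> euc m" and \<epsilon>: "\<epsilon> > 0"
    and supp: "\<And>u. u \<in> euc m \<Longrightarrow> \<epsilon> * norm u \<le> (\<Sum>i<N. \<bar>inner u (v i)\<bar>)"
  shows "measure (leb m) (segment_sum N v) > 0"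
proof -
  define S where "S = 1 + (\<Sum>i<N. norm (v i))"
  have S: "S > 0" unfolding S_def by (intro add_pos_nonneg sum_nonneg) auto
  have "(\<epsilon>\<^sup>2 / S) ^ m \<le> measure (leb m) (segment_sum N v)"
  proof (rule volume_segment_sum_ge[where q="\<lambda>i. norm (v i)"])
    fix x assume x: "x \<in> euc m"
    have "(\<epsilon> * norm x)\<^sup>2 \<le> (\<Sum>i<N. \<bar>inner x (v i)\<bar>)\<^sup>2"
      using supp[OF x] \<epsilon> by (intro power_mono) auto
    also have "\<dots> \<le> (\<Sum>i<N. norm (v i)) * (\<Sum>i<N. (inner x (v i))\<^sup>2 / norm (v i))"
      by (rule sum_abs_inner_sq_le)
    also have "\<dots> \<le> S * (\<Sum>i<N. (inner x (v i))\<^sup>2 / norm (v i))"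
      by (intro mult_right_mono sum_nonneg) (auto simp: S_def)
    finally show "\<epsilon>\<^sup>2 / S * (norm x)\<^sup>2 \<le> (\<Sum>i<N. (inner x (v i))\<^sup>2 / norm (v i))"
      using S by (simp add: power_mult_distrib field_simps)
  qed (use v S in auto)
  moreover have "(\<epsilon>\<^sup>2 / S) ^ m > 0" using \<epsilon> S by simp
  ultimately show ?thesis by linarith
qed

lemma c_lin_Z_zonoid_le:
  assumes n: "n \<ge> 1" and Z: "zonoid (2 * n) Z" and int: "top_of_set (euc (2 * n)) interior_of Z \<noteq> {}"
  shows "c_lin_Z n Z / ereal pi \<le> ereal (9216 * real n * vol (2 * n) Z powr (1 / n))"
proof -
  let ?m = "2 * n"
  have ZD: "Z \<subseteq> euc ?m" "compact Z" using Z by (auto simp: zonoid_def)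
  obtain N v \<epsilon> where v: "\<And>i. i < N \<Longrightarrow> v i \<in> euc ?m" and sub: "segment_sum N v \<subseteq> (\<lambda>x. 2 *\<^sub>R x) ` Z"
    and width: "\<And>u z. u \<in> euc ?m \<Longrightarrow> z \<in> Z \<Longrightarrow> \<bar>inner u z\<bar> \<le> 2 * (\<Sum>i<N. \<bar>inner u (v i)\<bar>)"
    and \<epsilon>: "\<epsilon> > 0" "\<And>u. u \<in> euc ?m \<Longrightarrow> \<epsilon> * norm u \<le> (\<Sum>i<N. \<bar>inner u (v i)\<bar>)"
    using zonoid_approx[OF Z int] by blast
  define V where "V = measure (leb ?m) (segment_sum N v)"
  have V: "V > 0" unfolding V_def by (rule measure_segment_sum_pos[OF v \<epsilon>])
  have V_le: "V powr (1 / n) \<le> 4 * vol ?m Z powr (1 / n)"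
  proof -
    have c2: "compact ((\<lambda>x. 2 *\<^sub>R x) ` Z)"
      using ZD by (intro compact_continuous_image continuous_intros)
    have "V \<le> measure (leb ?m) ((\<lambda>x. 2 *\<^sub>R x) ` Z)"
      unfolding V_def by (rule measure_leb_mono[OF compact_segment_sum c2 sub])
    also have "\<dots> = measure (leb ?m) Z * 2 ^ ?m"
      using ZD c2 by (intro scales_volume_measure[OF scales_volume_scaleR, symmetric]) auto
    also have "\<dots> = 4 ^ n * vol ?m Z"
      using vol_eq_leb[OF compact_borel[OF ZD(2)] ZD(1)] by (simp add: power_mult)
    finally have "V powr (1 / n) \<le> (4 ^ n * vol ?m Z) powr (1 / n)"
      using V by (intro powr_mono2) auto
    also have "\<dots> = 4 * vol ?m Z powr (1 / n)"
      using n by (simp add: powr_mult vol_def powr_realpow[symmetric] powr_powr)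
    finally show ?thesis .
  qed
  define \<rho> where "\<rho> = sqrt (192 * real n * V powr (1 / n))"
  have \<rho>: "\<rho> > 0" using V n by (simp add: \<rho>_def)
  obtain u w where uw: "u \<in> euc ?m" "w \<in> euc ?m" "omega_st n u w = 1"
    "(\<Sum>i<N. \<bar>inner u (v i)\<bar>) \<le> \<rho>" "(\<Sum>i<N. \<bar>inner w (v i)\<bar>) \<le> \<rho>"
    unfolding \<rho>_def V_def by (rule ex_sympl_pair_segment_sum[OF v n V[unfolded V_def]])
  have "c_lin_Z n Z \<le> ereal (pi * (3 * (2 * \<rho>)\<^sup>2))"
  proof (rule c_lin_Z_le[OF ZD(1) n uw(1,2,3)])
    fix z assume "z \<in> Z"
    with width[OF uw(1)] width[OF uw(2)] uw(4,5)
    show "\<bar>inner u z\<bar> \<le> 2 * \<rho> \<and> \<bar>inner w z\<bar> \<le> 2 * \<rho>" by force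
  qed (use \<rho> in simp)
  then have "c_lin_Z n Z / ereal pi \<le> ereal (pi * (3 * (2 * \<rho>)\<^sup>2)) / ereal pi"
    by (rule ereal_divide_right_mono) simp
  also have "\<dots> = ereal (3 * (2 * \<rho>)\<^sup>2)" by simp
  also have "\<dots> = ereal (2304 * real n * V powr (1 / n))"
    by (simp add: \<rho>_def power_mult_distrib)
  also have "\<dots> \<le> ereal (2304 * real n * (4 * vol ?m Z powr (1 / n)))"
    unfolding ereal_less_eq by (rule mult_left_mono[OF V_le]) simp
  also have "\<dots> = ereal (9216 * real n * vol ?m Z powr (1 / n))" by simp
  finally show ?thesis .
qed

theorem mainTheorem3:
  shows "\<exists>A::real. A > 0 \<and>
    (\<forall>n::nat. \<forall>Z::fin_seq set.
       n \<ge> 1 \<longrightarrow> zonoid (2*n) Z \<longrightarrow> top_of_set (euc (2*n)) interior_of Z \<noteq> {} \<longrightarrow>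
       c_lin_Z n Z / ereal pi
         \<le> ereal (A * (vol (2*n) Z / vol (2*n) (euc_ball (2*n) 1)) powr (1 / real n)))"
proof (intro exI[of _ 110592] conjI allI impI)
  fix n Z
  assume n: "n \<ge> 1" and Z: "zonoid (2*n) Z" "top_of_set (euc (2*n)) interior_of Z \<noteq> {}"
  define \<beta> where "\<beta> = vol (2*n) (euc_ball (2*n) 1)"
  define W where "W = vol (2*n) Z"
  have W: "W \<ge> 0" by (simp add: W_def vol_def)
  have \<beta>: "\<beta> > 0" "\<beta> \<le> (12 / n) ^ n" unfolding \<beta>_def by (rule vol_euc_ball[OF n])+
  have "\<beta> powr (1 / n) \<le> ((12 / n) ^ n) powr (1 / n)"
    using \<beta> by (intro powr_mono2) auto
  also have "\<dots> = 12 / n" using n by (simp add: powr_realpow[symmetric] powr_powr)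
  finally have "n * \<beta> powr (1 / n) \<le> 12" using n by (simp add: field_simps)
  then have "n * \<beta> powr (1 / n) * (W / \<beta>) powr (1 / n) \<le> 12 * (W / \<beta>) powr (1 / n)"
    by (intro mult_right_mono) auto
  also have "n * \<beta> powr (1 / n) * (W / \<beta>) powr (1 / n) = n * W powr (1 / n)"
    using \<beta> W by (simp add: powr_divide)
  finally have "9216 * real n * W powr (1 / n) \<le> 110592 * (W / \<beta>) powr (1 / n)" by simp
  moreover have "c_lin_Z n Z / ereal pi \<le> ereal (9216 * real n * W powr (1 / n))"
    unfolding W_def by (rule c_lin_Z_zonoid_le[OF n Z])
  ultimately show "c_lin_Z n Z / ereal pi
      \<le> ereal (110592 * (vol (2*n) Z / vol (2*n) (euc_ball (2*n) 1)) powr (1 / real n))"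
    unfolding W_def \<beta>_def by (meson ereal_less_eq(3) order_trans)
qed simp

end
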